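(* Let $k$ be an algebraically closed field of characteristic $0$, let $Q$ be a finite quiver with stability $\Theta$ and associated slope function $\mu$. Let $\mathbf d$ be a stable dimension vector and suppose that, for each proper decomposition $\mathbf d=\mathbf e+\mathbf f$ (that is, $\mathbf e,\mathbf f$ are non-zero dimension vectors) with $\mu(\mathbf e)\ge\mu(\mathbf f)$, we have $\langle\mathbf e,\mathbf f\rangle\le-2$. Then $\mathbf d$ is amply stable.
   Context: A quiver $Q$ has a finite set of vertices $Q_0$ and a finite set of arrows $Q_1$, written $\alpha:i\to j$. Dimension vectors are elements $\mathbf d=(d_i)_{i\in Q_0}\in\mathbb N Q_0$ (with $0\in\mathbb N$), and $\dim\mathbf d=\sum_i d_i$. The Euler form is $\langle\mathbf d,\mathbf e\rangle=\sum_{i\in Q_0}d_ie_i-\sum_{\alpha:i\to j}d_ie_j$. A stability is a linear functional $\Theta\in(\mathbb R Q_0)^*$; its slope function is $\mu(\mathbf d)=\Theta(\mathbf d)/\dim\mathbf d$ for $\mathbf d\neq0$. A representation $V$ consists of finite-dimensional $k$-vector spaces $V_i$ ($i\in Q_0$) and linear maps $V_\alpha:V_i\to V_j$ for $\alpha:i\to j$; the slope of $V\neq0$ is $\mu(V)=\mu((\dim V_i)_i)$. A non-zero representation $V$ is stable if $\mu(U)<\mu(V)$ for all non-zero proper subrepresentations $U\subset V$. For fixed vector spaces $V_i$ with $\dim V_i=d_i$, $R_{\mathbf d}(Q)=\bigoplus_{\alpha:i\to j}\operatorname{Hom}_k(V_i,V_j)$ is viewed as an affine space over $k$, and $R^{\rm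 st}_{\mathbf d}(Q)\subset R_{\mathbf d}(Q)$ is the open locus of stable representations. The dimension vector $\mathbf d$ is called stable if $R^{\rm st}_{\mathbf d}(Q)\ne\emptyset$, and amply stable if $\operatorname{codim}_{R_{\mathbf d}(Q)}\bigl(R_{\mathbf d}(Q)\smallsetminus R^{\rm st}_{\mathbf d}(Q)\bigr)\ge2$. *)

theory Defs
  imports
    "Graph_Theory.Digraph"
    "Jordan_Normal_Form.VS_Connect"
    "HOL-Analysis.Abstract_Topology"
    "HOL-Library.Extended_Nat"
    "HOL-Library.FuncSet"
begin

section \<open>Zariski topology and codimension\<close>

text \<open>The functions \<open>'p \<Rightarrow> 'k\<close> that are polynomial expressions in the given coordinate functions.\<close>

inductive_set polynomial_functions :: "('p \<Rightarrow> 'k::comm_ring_1) set \<Rightarrow> ('p \<Rightarrow> 'k) set"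
  for C :: "('p \<Rightarrow> 'k) set" where
  const: "(\<lambda>_. c) \<in> polynomial_functions C"
| coord: "x \<in> C \<Longrightarrow> x \<in> polynomial_functions C"
| add: "f \<in> polynomial_functions C \<Longrightarrow> g \<in> polynomial_functions C
    \<Longrightarrow> (\<lambda>p. f p + g p) \<in> polynomial_functions C"
| mult: "f \<in> polynomial_functions C \<Longrightarrow> g \<in> polynomial_functions C
    \<Longrightarrow> (\<lambda>p. f p * g p) \<in> polynomial_functions C"

definition zero_locus :: "'p set \<Rightarrow> ('p \<Rightarrow> 'k::zero) set \<Rightarrow> 'p set" where
  "zero_locus X F = {p \<in> X. \<forall>f\<in>F. f p = 0}"

definition zariski_topology :: "'p set \<Rightarrow> ('p \<Rightarrow> 'k::idom) set \<Rightarrow> 'p topology" where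
  "zariski_topology X C =
     topology (\<lambda>U. \<exists>F \<subseteq> polynomial_functions C. U = X - zero_locus X F)"

lemma istopology_zariski:
  fixes C :: "('p \<Rightarrow> 'k::idom) set"
  shows "istopology (\<lambda>U. \<exists>F \<subseteq> polynomial_functions C. U = X - zero_locus X F)"
proof -
  let ?P = "polynomial_functions C"
  have inter: "\<exists>F\<subseteq>?P. S \<inter> T = X - zero_locus X F"
    if "\<exists>F\<subseteq>?P. S = X - zero_locus X F" "\<exists>F\<subseteq>?P. T = X - zero_locus X F" for S T
  proof -
    from that obtain F G where FG: "F \<subseteq> ?P" "G \<subseteq> ?P"
      "S = X - zero_locus X F" "T = X - zero_locus X G" by blast
    let ?H = "(\<lambda>(f, g) p. f p * g p) ` (F \<times> G)"
    have "?H \<subseteq> ?P"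
    proof safe
      fix f g assume "f \<in> F" "g \<in> G"
      with FG(1,2) have "f \<in> ?P" "g \<in> ?P" by blast+
      then show "(\<lambda>p. f p * g p) \<in> ?P" by (rule polynomial_functions.mult)
    qed
    moreover have "S \<inter> T = X - zero_locus X ?H"
      unfolding FG(3,4) zero_locus_def by fastforce
    ultimately show ?thesis by blast
  qed
  have union: "\<exists>F\<subseteq>?P. \<Union>K = X - zero_locus X F"
    if "\<forall>S\<in>K. \<exists>F\<subseteq>?P. S = X - zero_locus X F" for K
  proof -
    from that obtain F where F: "\<forall>S\<in>K. F S \<subseteq> ?P \<and> S = X - zero_locus X (F S)" by metis
    have "\<Union>K = (\<Union>S\<in>K. X - zero_locus X (F S))" using F by blast
    also have "\<dots> = X - zero_locus X (\<Union>S\<in>K. F S)" by (auto simp: zero_locus_def)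
    finally have "\<Union>K = X - zero_locus X (\<Union>S\<in>K. F S)" .
    moreover have "(\<Union>S\<in>K. F S) \<subseteq> ?P" using F by blast
    ultimately show ?thesis by blast
  qed
  show ?thesis
    unfolding istopology_def by (intro conjI allI impI inter union) auto
qed

lemma openin_zariski:
  "openin (zariski_topology X C) U \<longleftrightarrow> (\<exists>F \<subseteq> polynomial_functions C. U = X - zero_locus X F)"
  unfolding zariski_topology_def by (simp add: topology_inverse'[OF istopology_zariski])

lemma topspace_zariski [simp]: "topspace (zariski_topology X C) = X"
proof -
  have "openin (zariski_topology X C) X"
    unfolding openin_zariski
    by (rule exI[of _ "{\<lambda>_. 1}"]) (auto simp: zero_locus_def intro: polynomial_functions.const)
  moreover have "U \<subseteq> X" if "openin (zariski_topology X C) U" for U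
    using that unfolding openin_zariski by blast
  ultimately show ?thesis unfolding topspace_def by blast
qed

lemma closedin_zariski:
  "closedin (zariski_topology X C) Z \<longleftrightarrow> (\<exists>F \<subseteq> polynomial_functions C. Z = zero_locus X F)"
proof -
  have "zero_locus X F \<subseteq> X" for F :: "('a \<Rightarrow> 'b) set" by (auto simp: zero_locus_def)
  then show ?thesis
    unfolding closedin_def openin_zariski topspace_zariski by (metis double_diff order_refl)
qed

definition irreducible_closedin :: "'p topology \<Rightarrow> 'p set \<Rightarrow> bool" where
  "irreducible_closedin T Z \<longleftrightarrow> closedin T Z \<and> Z \<noteq> {} \<and>
     (\<forall>A B. closedin T A \<and> closedin T B \<and> Z = A \<union> B \<longrightarrow> Z = A \<or> Z = B)"

definition irreducible_codim :: "'p topology \<Rightarrow> 'p set \<Rightarrow> enat" where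
  "irreducible_codim T Y =
     Sup {enat n | n. \<exists>Z :: nat \<Rightarrow> 'p set. Z 0 = Y \<and>
            (\<forall>i\<le>n. irreducible_closedin T (Z i)) \<and> (\<forall>i<n. Z i \<subset> Z (Suc i))}"

text \<open>
  For closed \<open>S\<close> this is the usual codimension, the infimum over the irreducible closed
  subsets of \<open>S\<close> (equivalently, over its irreducible components); an arbitrary \<open>S\<close> is given the
  codimension of its closure. The empty set has codimension \<open>\<infinity>\<close>.
\<close>

definition codim :: "'p topology \<Rightarrow> 'p set \<Rightarrow> enat" where
  "codim T S = (INF Y \<in> {Y. irreducible_closedin T Y \<and> Y \<subseteq> Abstract_Topology.closure_of T S}. irreducible_codim T Y)"


section \<open>Dimension vectors and stability\<close>

text \<open>
  A quiver is a finite directed multigraph, i.e. a \<open>pre_digraph\<close> satisfying \<open>fin_digraph\<close>;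
  an arrow \<open>\<alpha> : i \<rightarrow> j\<close> has tail \<open>i\<close> and head \<open>j\<close>.
  Elements of \<open>\<nat>Q\<^sub>0\<close> and \<open>\<real>Q\<^sub>0\<close> are functions on the vertex type vanishing off the vertex set.
\<close>

definition dimension_vectors :: "('v, 'a) pre_digraph \<Rightarrow> ('v \<Rightarrow> nat) set" where
  "dimension_vectors Q = {d. \<forall>i. i \<notin> verts Q \<longrightarrow> d i = 0}"

definition real_vertex_space :: "('v, 'a) pre_digraph \<Rightarrow> ('v \<Rightarrow> real) set" where
  "real_vertex_space Q = {x. \<forall>i. i \<notin> verts Q \<longrightarrow> x i = 0}"

definition euler_form :: "('v, 'a) pre_digraph \<Rightarrow> ('v \<Rightarrow> nat) \<Rightarrow> ('v \<Rightarrow> nat) \<Rightarrow> int" where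
  "euler_form Q d e =
     (\<Sum>i\<in>verts Q. int (d i) * int (e i)) - (\<Sum>a\<in>arcs Q. int (d (tail Q a)) * int (e (head Q a)))"

definition is_stability :: "('v, 'a) pre_digraph \<Rightarrow> (('v \<Rightarrow> real) \<Rightarrow> real) \<Rightarrow> bool" where
  "is_stability Q \<Theta> \<longleftrightarrow>
     (\<forall>x\<in>real_vertex_space Q. \<forall>y\<in>real_vertex_space Q. \<Theta> (\<lambda>i. x i + y i) = \<Theta> x + \<Theta> y) \<and>
     (\<forall>c. \<forall>x\<in>real_vertex_space Q. \<Theta> (\<lambda>i. c * x i) = c * \<Theta> x)"

definition slope ::
  "('v, 'a) pre_digraph \<Rightarrow> (('v \<Rightarrow> real) \<Rightarrow> real) \<Rightarrow> ('v \<Rightarrow> nat) \<Rightarrow> real" where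
  "slope Q \<Theta> d = \<Theta> (\<lambda>i. real (d i)) / real (\<Sum>i\<in>verts Q. d i)"


section \<open>Representations\<close>

text \<open>The variety \<open>R\<^sub>d(Q)\<close>, for the fixed vector spaces \<open>V\<^sub>i = k\<^bsup>d i\<^esup>\<close>.\<close>

definition rep_space :: "('v, 'a) pre_digraph \<Rightarrow> ('v \<Rightarrow> nat) \<Rightarrow> ('a \<Rightarrow> 'k mat) set" where
  "rep_space Q d = (\<Pi>\<^sub>E a\<in>arcs Q. carrier_mat (d (head Q a)) (d (tail Q a)))"

definition rep_coordinates :: "('v, 'a) pre_digraph \<Rightarrow> ('v \<Rightarrow> nat) \<Rightarrow> (('a \<Rightarrow> 'k mat) \<Rightarrow> 'k) set" where
  "rep_coordinates Q d =
     {\<lambda>M. M a $$ (r, c) | a r c. a \<in> arcs Q \<and> r < d (head Q a) \<and> c < d (tail Q a)}"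

definition rep_topology ::
  "('v, 'a) pre_digraph \<Rightarrow> ('v \<Rightarrow> nat) \<Rightarrow> ('a \<Rightarrow> 'k::field mat) topology" where
  "rep_topology Q d = zariski_topology (rep_space Q d) (rep_coordinates Q d)"

text \<open>A family \<open>U\<close> is only constrained, and only used, at the vertices of \<open>Q\<close>.\<close>

definition subrepresentation ::
  "('v, 'a) pre_digraph \<Rightarrow> ('v \<Rightarrow> nat) \<Rightarrow> ('a \<Rightarrow> 'k::field mat) \<Rightarrow> ('v \<Rightarrow> 'k vec set) \<Rightarrow> bool" where
  "subrepresentation Q d M U \<longleftrightarrow>
     (\<forall>i\<in>verts Q. VectorSpace.subspace class_ring (U i) (module_vec TYPE('k) (d i))) \<and>
     (\<forall>a\<in>arcs Q. \<forall>x\<in>U (tail Q a). M a *\<^sub>v x \<in> U (head Q a))"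

definition subrep_dim ::
  "('v, 'a) pre_digraph \<Rightarrow> ('v \<Rightarrow> nat) \<Rightarrow> ('v \<Rightarrow> 'k::field vec set) \<Rightarrow> 'v \<Rightarrow> nat" where
  "subrep_dim Q d U = (\<lambda>i. if i \<in> verts Q
     then vectorspace.dim class_ring ((module_vec TYPE('k) (d i))\<lparr>carrier := U i\<rparr>) else 0)"

definition stable_rep ::
  "('v, 'a) pre_digraph \<Rightarrow> (('v \<Rightarrow> real) \<Rightarrow> real) \<Rightarrow> ('v \<Rightarrow> nat) \<Rightarrow> ('a \<Rightarrow> 'k::field mat) \<Rightarrow> bool" where
  "stable_rep Q \<Theta> d M \<longleftrightarrow> (\<exists>i\<in>verts Q. d i \<noteq> 0) \<and>
     (\<forall>U. subrepresentation Q d M U \<and> (\<exists>i\<in>verts Q. U i \<noteq> {0\<^sub>v (d i)}) \<and>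
          (\<exists>i\<in>verts Q. U i \<noteq> carrier_vec (d i))
        \<longrightarrow> slope Q \<Theta> (subrep_dim Q d U) < slope Q \<Theta> d)"

definition stable_locus ::
  "('v, 'a) pre_digraph \<Rightarrow> (('v \<Rightarrow> real) \<Rightarrow> real) \<Rightarrow> ('v \<Rightarrow> nat) \<Rightarrow> ('a \<Rightarrow> 'k::field mat) set" where
  "stable_locus Q \<Theta> d = {M \<in> rep_space Q d. stable_rep Q \<Theta> d M}"

text \<open>The ground field enters the next two notions only through its type.\<close>

definition stable_dimension_vector ::
  "'k::field itself \<Rightarrow> ('v, 'a) pre_digraph \<Rightarrow> (('v \<Rightarrow> real) \<Rightarrow> real) \<Rightarrow> ('v \<Rightarrow> nat) \<Rightarrow> bool" where
  "stable_dimension_vector _ Q \<Theta> d \<longleftrightarrow>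
     d \<in> dimension_vectors Q \<and> (stable_locus Q \<Theta> d :: ('a \<Rightarrow> 'k mat) set) \<noteq> {}"

definition amply_stable ::
  "'k::field itself \<Rightarrow> ('v, 'a) pre_digraph \<Rightarrow> (('v \<Rightarrow> real) \<Rightarrow> real) \<Rightarrow> ('v \<Rightarrow> nat) \<Rightarrow> bool" where
  "amply_stable _ Q \<Theta> d \<longleftrightarrow> d \<in> dimension_vectors Q \<and>
     codim (rep_topology Q d) (rep_space Q d - stable_locus Q \<Theta> d :: ('a \<Rightarrow> 'k mat) set) \<ge> 2"

end

theory Submission
  imports Defs "HOL-Library.Function_Algebras"
begin

text \<open>
  A non-zero representation is not stable iff it has a subrepresentation of some dimension vector \<open>e\<noteq>0, d\<close> with
  \<open>\<mu>(e) \<ge> \<mu>(d - e)\<close>. Every subspace of \<open>k\<^bsup>n\<^esup>\<close> is the graph of a linear map between complementary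
  coordinate subspaces, so the representations with a subrepresentation of dimension vector \<open>e\<close>
  are covered by finitely many images of polynomial maps from affine spaces of dimension
  \<open>dim R\<^sub>d(Q) + \<langle>e, d - e\<rangle> \<le> dim R\<^sub>d(Q) - 2\<close>.
  The closure \<open>W\<close> of such an image is irreducible. It is a proper subset, so it is not invariant
  under translation in some coordinate direction; adding a parameter for this translation gives
  an irreducible closed \<open>Z\<close> with \<open>W \<subset> Z\<close>, and \<open>Z\<close> is still proper because it is the closure of an
  image of an affine space of smaller dimension. The chains \<open>Y \<subset> Z \<subset> R\<^sub>d(Q)\<close> with \<open>Y \<subseteq> W\<close> give
  codimension at least two.
\<close>

section \<open>Closures of images of polynomial maps\<close>

lemma polynomial_functions_diff:
  assumes "f \<in> polynomial_functions C" "g \<in> polynomial_functions C"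
  shows "(\<lambda>p. f p - g p) \<in> polynomial_functions C"
proof -
  have "(\<lambda>p. f p + (\<lambda>_. -1) p * g p) \<in> polynomial_functions C"
    by (intro polynomial_functions.add polynomial_functions.mult polynomial_functions.const assms)
  then show ?thesis by simp
qed

lemma polynomial_functions_sum:
  assumes "\<And>s. s \<in> S \<Longrightarrow> f s \<in> polynomial_functions C"
  shows "(\<lambda>p. \<Sum>s\<in>S. f s p) \<in> polynomial_functions C"
  using assms
  by (induction S rule: infinite_finite_induct)
    (auto intro: polynomial_functions.const polynomial_functions.add)

lemma polynomial_functions_prod:
  assumes "\<And>s. s \<in> S \<Longrightarrow> f s \<in> polynomial_functions C"
  shows "(\<lambda>p. \<Prod>s\<in>S. f s p) \<in> polynomial_functions C"
  using assms
  by (induction S rule: infinite_finite_induct)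
    (auto intro: polynomial_functions.const polynomial_functions.mult)

lemma polynomial_functions_compose:
  assumes "f \<in> polynomial_functions C"
    and "\<And>c. c \<in> C \<Longrightarrow> (\<lambda>u. c (\<phi> u)) \<in> polynomial_functions D"
  shows "(\<lambda>u. f (\<phi> u)) \<in> polynomial_functions D"
  using assms(1)
  by induction (auto intro: polynomial_functions.intros assms(2))

section \<open>Polynomials on affine space and irreducibility of closures of images\<close>

definition coordinate_functions :: "'i set \<Rightarrow> (('i \<Rightarrow> 'k) \<Rightarrow> 'k) set" where
  "coordinate_functions I = (\<lambda>i u. u i) ` I"

lemma coordinate_polynomial:
  "i \<in> I \<Longrightarrow> (\<lambda>u. u i) \<in> polynomial_functions (coordinate_functions I)"
  by (auto simp: coordinate_functions_def intro: polynomial_functions.coord)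

text \<open>Restriction to a line reduces questions about polynomials in many variables to counting
  roots of a polynomial in one variable.\<close>

lemma polynomial_on_line:
  fixes f :: "('i \<Rightarrow> 'k::comm_ring_1) \<Rightarrow> 'k"
  assumes "f \<in> polynomial_functions (coordinate_functions I)"
  shows "\<exists>q. \<forall>t. f (\<lambda>i. u i + t * v i) = poly q t"
  using assms
proof induction
  case (const c)
  show ?case by (rule exI[of _ "[:c:]"]) simp
next
  case (coord x)
  then obtain i where "x = (\<lambda>u. u i)" by (auto simp: coordinate_functions_def)
  then show ?case by (intro exI[of _ "[:u i, v i:]"]) simp
next
  case (add f g)
  then show ?case by (metis poly_add)
next
  case (mult f g)
  then show ?case by (metis poly_mult)
qed

text \<open>This is the irreducibility of affine space in terms of functions. On the line through
  \<open>u\<close> and \<open>v\<close> both restrictions are non-zero polynomials, so their product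
  has finitely many roots, and a field of characteristic zero is infinite.\<close>

lemma polynomial_common_nonzero:
  fixes f g :: "('i \<Rightarrow> 'k::field_char_0) \<Rightarrow> 'k"
  assumes f: "f \<in> polynomial_functions (coordinate_functions I)" "f u \<noteq> 0"
    and g: "g \<in> polynomial_functions (coordinate_functions I)" "g v \<noteq> 0"
  obtains w where "f w \<noteq> 0" "g w \<noteq> 0"
proof -
  define line where "line t = (\<lambda>i. u i + t * (v i - u i))" for t
  have ends: "line 0 = u" "line 1 = v" by (auto simp: line_def)
  obtain p where p: "f (line t) = poly p t" for t
    using polynomial_on_line[OF f(1), of u "\<lambda>i. v i - u i"] unfolding line_def by blast
  obtain q where q: "g (line t) = poly q t" for t
    using polynomial_on_line[OF g(1), of u "\<lambda>i. v i - u i"] unfolding line_def by blast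
  have "poly p 0 \<noteq> 0" "poly q 1 \<noteq> 0"
    using f(2) g(2) by (simp_all add: p[symmetric] q[symmetric] ends)
  then have "p * q \<noteq> 0" by auto
  then have "finite {t. poly (p * q) t = 0}" by (rule poly_roots_finite)
  then obtain t where "poly (p * q) t \<noteq> 0"
    using infinite_UNIV_char_0[where 'a = 'k] by (metis (mono_tags) UNIV_eq_I mem_Collect_eq)
  then show thesis using that[of "line t"] by (simp add: p q)
qed

abbreviation zariski_closure :: "'p set \<Rightarrow> ('p \<Rightarrow> 'k::idom) set \<Rightarrow> 'p set \<Rightarrow> 'p set" where
  "zariski_closure X C S \<equiv> Abstract_Topology.closure_of (zariski_topology X C) S"

text \<open>If two proper closed pieces covered the closure, each would have an equation that is
  non-zero somewhere on the image. Pulled back along \<open>\<phi>\<close>, the two equations have a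
  common point of non-vanishing, whose image lies in neither piece.\<close>

lemma irreducible_closure_of_image:
  fixes \<phi> :: "('i \<Rightarrow> 'k::field_char_0) \<Rightarrow> 'p" and C :: "('p \<Rightarrow> 'k) set"
  assumes X: "range \<phi> \<subseteq> X"
    and C: "\<And>c. c \<in> C \<Longrightarrow> (\<lambda>u. c (\<phi> u)) \<in> polynomial_functions (coordinate_functions I)"
  shows "irreducible_closedin (zariski_topology X C) (zariski_closure X C (range \<phi>))"
proof -
  let ?T = "zariski_topology X C"
  have sub: "range \<phi> \<subseteq> zariski_closure X C (range \<phi>)"
    using X by (simp add: closure_of_subset)
  \<comment> \<open>The closure is the least closed set containing the image, so a proper closed
    piece cannot contain the whole image.\<close>
  have nonvanishing: "\<exists>f\<in>F. \<exists>u. f (\<phi> u) \<noteq> 0"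
    if "zariski_closure X C (range \<phi>) = zero_locus X F \<union> B" "zariski_closure X C (range \<phi>) \<noteq> zero_locus X F"
      "F \<subseteq> polynomial_functions C" for F B
  proof (rule ccontr)
    assume "\<not> ?thesis"
    then have "range \<phi> \<subseteq> zero_locus X F" using X by (auto simp: zero_locus_def)
    then have "zariski_closure X C (range \<phi>) \<subseteq> zero_locus X F"
      using that(3) by (intro closure_of_minimal) (auto simp: closedin_zariski)
    with that show False by blast
  qed
  have "A = zariski_closure X C (range \<phi>) \<or> B = zariski_closure X C (range \<phi>)"
    if AB: "closedin ?T A" "closedin ?T B" "zariski_closure X C (range \<phi>) = A \<union> B" for A B
  proof (rule ccontr)
    assume neq: "\<not> ?thesis"
    obtain F G where FG: "F \<subseteq> polynomial_functions C" "A = zero_locus X F"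
      "G \<subseteq> polynomial_functions C" "B = zero_locus X G"
      using AB by (auto simp: closedin_zariski)
    obtain f u where f: "f \<in> F" "f (\<phi> u) \<noteq> 0"
      using nonvanishing[of F B] AB FG neq by metis
    obtain g v where g: "g \<in> G" "g (\<phi> v) \<noteq> 0"
      using nonvanishing[of G A] AB FG neq by (metis sup_commute)
    have pull: "(\<lambda>u. h (\<phi> u)) \<in> polynomial_functions (coordinate_functions I)" if "h \<in> F \<union> G" for h
      using that FG by (intro polynomial_functions_compose[OF _ C]) auto
    obtain w where "f (\<phi> w) \<noteq> 0" "g (\<phi> w) \<noteq> 0"
      using polynomial_common_nonzero[of "\<lambda>u. f (\<phi> u)" I u "\<lambda>u. g (\<phi> u)" v] pull f g by blast
    moreover have "\<phi> w \<in> A \<union> B" using sub AB by auto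
    ultimately show False using f g FG by (auto simp: zero_locus_def)
  qed
  moreover have "zariski_closure X C (range \<phi>) \<noteq> {}" using sub by auto
  ultimately show ?thesis unfolding irreducible_closedin_def by auto
qed

text \<open>Intersecting \<open>Y\<close> with one member and with the union of the others writes it
  as a union of two closed sets, so the claim follows by induction on \<open>S\<close>.\<close>

lemma irreducible_subset_finite_Union:
  assumes "irreducible_closedin T Y" "finite S" "\<And>s. s \<in> S \<Longrightarrow> closedin T (W s)"
    and "Y \<subseteq> (\<Union>s\<in>S. W s)"
  shows "\<exists>s\<in>S. Y \<subseteq> W s"
  using assms(2-)
proof (induction S)
  case empty
  then show ?case using assms(1) by (auto simp: irreducible_closedin_def)
next
  case (insert s S)
  have Y: "closedin T Y" using assms(1) by (auto simp: irreducible_closedin_def)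
  have c: "closedin T (Y \<inter> W s)" "closedin T (Y \<inter> (\<Union>s\<in>S. W s))"
    using insert Y by (auto intro!: closedin_Int closedin_Union)
  have "Y = (Y \<inter> W s) \<union> (Y \<inter> (\<Union>s\<in>S. W s))" using insert.prems by auto
  then have "Y = Y \<inter> W s \<or> Y = Y \<inter> (\<Union>s\<in>S. W s)"
    using assms(1) c unfolding irreducible_closedin_def by blast
  then show ?case using insert.IH insert.prems(1) by blast
qed

section \<open>Polynomial maps to a space of larger dimension\<close>

interpretation function_space:
  vector_space "\<lambda>(c::'k::field) (f::'x \<Rightarrow> 'k) x. c * f x"
  by unfold_locales (auto simp: algebra_simps fun_eq_iff)

text \<open>The bound applies to the exponent of each variable separately, not to the total degree.
  This makes the count a plain power, \<open>(D + 1) ^ card I\<close>, directly comparable with the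
  size of a grid.\<close>

definition monomials :: "'i set \<Rightarrow> nat \<Rightarrow> (('i \<Rightarrow> 'k::field) \<Rightarrow> 'k) set" where
  "monomials I D = (\<lambda>\<alpha> u. \<Prod>i\<in>I. u i ^ \<alpha> i) ` (I \<rightarrow>\<^sub>E {..D})"

abbreviation bounded_degree :: "'i set \<Rightarrow> nat \<Rightarrow> (('i \<Rightarrow> 'k::field) \<Rightarrow> 'k) set" where
  "bounded_degree I D \<equiv> function_space.span (monomials I D)"

lemma finite_monomials: "finite I \<Longrightarrow> finite (monomials I D)"
  unfolding monomials_def by (intro finite_imageI finite_PiE) auto

lemma card_monomials_le:
  assumes "finite I"
  shows "card (monomials I D :: (('i \<Rightarrow> 'k::field) \<Rightarrow> 'k) set) \<le> (D + 1) ^ card I"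
proof -
  have "card (monomials I D :: (('i \<Rightarrow> 'k) \<Rightarrow> 'k) set) \<le> card (I \<rightarrow>\<^sub>E {..D})"
    unfolding monomials_def using assms by (intro card_image_le finite_PiE) auto
  then show ?thesis using assms by (simp add: card_PiE)
qed

lemma monomialI:
  assumes "\<And>i. i \<in> I \<Longrightarrow> \<alpha> i \<le> D"
  shows "(\<lambda>u. \<Prod>i\<in>I. u i ^ \<alpha> i) \<in> monomials I D"
proof -
  have "(\<lambda>u. \<Prod>i\<in>I. u i ^ \<alpha> i) = (\<lambda>u. \<Prod>i\<in>I. u i ^ restrict \<alpha> I i)" by auto
  moreover have "restrict \<alpha> I \<in> I \<rightarrow>\<^sub>E {..D}" using assms by auto
  ultimately show ?thesis unfolding monomials_def by blast
qed

lemma monomials_mono: "D \<le> E \<Longrightarrow> monomials I D \<subseteq> monomials I E"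
  unfolding monomials_def by (intro image_mono PiE_mono) auto

lemma bounded_degree_mono: "D \<le> E \<Longrightarrow> f \<in> bounded_degree I D \<Longrightarrow> f \<in> bounded_degree I E"
  using function_space.span_mono[OF monomials_mono] by blast

lemma bounded_degree_add:
  "f \<in> bounded_degree I D \<Longrightarrow> g \<in> bounded_degree I D \<Longrightarrow> (\<lambda>u. f u + g u) \<in> bounded_degree I D"
  using function_space.span_add[of f _ g] by (simp add: plus_fun_def)

lemma bounded_degree_const: "(\<lambda>_. c) \<in> bounded_degree I D"
proof -
  have "(\<lambda>_. 1) \<in> monomials I D" using monomialI[of I "\<lambda>_. 0" D] by simp
  then have "(\<lambda>_. c * 1) \<in> bounded_degree I D"
    by (intro function_space.span_scale function_space.span_base)
  then show ?thesis by simp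
qed

text \<open>Exponents add when monomials are multiplied; bilinearity carries this over to the spans,
  one factor at a time.\<close>

lemma bounded_degree_mult:
  fixes f g :: "('i \<Rightarrow> 'k::field) \<Rightarrow> 'k"
  assumes "f \<in> bounded_degree I D" "g \<in> bounded_degree I E"
  shows "(\<lambda>u. f u * g u) \<in> bounded_degree I (D + E)"
proof -
  have mono: "(\<lambda>u. a u * b u) \<in> monomials I (D + E)"
    if m: "a \<in> monomials I D" "b \<in> monomials I E" for a b :: "('i \<Rightarrow> 'k) \<Rightarrow> 'k"
  proof -
    obtain \<alpha> \<beta> where ab: "\<alpha> \<in> I \<rightarrow>\<^sub>E {..D}" "\<beta> \<in> I \<rightarrow>\<^sub>E {..E}"
      "a = (\<lambda>u. \<Prod>i\<in>I. u i ^ \<alpha> i)" "b = (\<lambda>u. \<Prod>i\<in>I. u i ^ \<beta> i)"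
      using m unfolding monomials_def by blast
    have "(\<lambda>u. \<Prod>i\<in>I. u i ^ (\<alpha> i + \<beta> i)) \<in> monomials I (D + E)"
      using ab(1,2) by (intro monomialI add_mono) auto
    then show ?thesis by (simp add: ab power_add prod.distrib)
  qed
  have right: "(\<lambda>u. a u * g u) \<in> bounded_degree I (D + E)" if a: "a \<in> monomials I D" for a
    using assms(2)
  proof (induction rule: function_space.span_induct_alt)
    case base
    then show ?case using bounded_degree_const[of 0] by simp
  next
    case (step c b h)
    have "(\<lambda>u. c * (a u * b u)) \<in> bounded_degree I (D + E)"
      using mono[OF a step(1)] by (intro function_space.span_scale function_space.span_base)
    from bounded_degree_add[OF this step(2)] show ?case
      by (simp add: algebra_simps)
  qed
  show ?thesis
    using assms(1)
  proof (induction rule: function_space.span_induct_alt)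
    case base
    then show ?case using bounded_degree_const[of 0] by simp
  next
    case (step c a h)
    have "(\<lambda>u. c * (a u * g u)) \<in> bounded_degree I (D + E)"
      using right[OF step(1)] by (rule function_space.span_scale)
    from bounded_degree_add[OF this step(2)] show ?case
      by (simp add: algebra_simps)
  qed
qed

lemma bounded_degree_prod:
  assumes "finite S" "\<And>s. s \<in> S \<Longrightarrow> f s \<in> bounded_degree I D"
  shows "(\<lambda>u. \<Prod>s\<in>S. f s u) \<in> bounded_degree I (card S * D)"
  using assms
proof (induction S)
  case empty
  then show ?case by (simp add: bounded_degree_const)
next
  case (insert s S)
  then show ?case using bounded_degree_mult[of "f s" I D] by simp
qed

lemma polynomial_bounded_degree:
  fixes f :: "('i \<Rightarrow> 'k::field) \<Rightarrow> 'k"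
  assumes "finite I" "f \<in> polynomial_functions (coordinate_functions I)"
  shows "\<exists>D. f \<in> bounded_degree I D"
  using assms(2)
proof induction
  case (const c)
  show ?case using bounded_degree_const by blast
next
  case (coord x)
  then obtain j where j: "j \<in> I" "x = (\<lambda>u. u j)" by (auto simp: coordinate_functions_def)
  have "(\<lambda>u :: 'i \<Rightarrow> 'k. \<Prod>i\<in>I. u i ^ (if i = j then 1 else 0)) \<in> monomials I 1" by (rule monomialI) auto
  moreover have "(\<Prod>i\<in>I. u i ^ (if i = j then 1 else 0)) = u j" for u :: "'i \<Rightarrow> 'k"
  proof -
    have "(\<Prod>i\<in>I. u i ^ (if i = j then 1 else 0)) = (\<Prod>i\<in>I. if i = j then u i else 1)"
      by (rule prod.cong) auto
    then show ?thesis using assms(1) j by simp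
  qed
  ultimately have "x \<in> monomials I 1" by (simp add: j(2))
  then show ?case by (blast intro: function_space.span_base)
next
  case (add f g)
  then obtain D E where "f \<in> bounded_degree I D" "g \<in> bounded_degree I E" by blast
  then have "f \<in> bounded_degree I (max D E)" "g \<in> bounded_degree I (max D E)"
    using bounded_degree_mono[of D "max D E" f I] bounded_degree_mono[of E "max D E" g I] by auto
  then show ?case using bounded_degree_add by blast
next
  case (mult f g)
  then show ?case using bounded_degree_mult by blast
qed

lemma sum_fun_apply: "(\<Sum>a\<in>A. f a) x = (\<Sum>a\<in>A. f a x)"
  by (induction A rule: infinite_finite_induct) auto

text \<open>The Lagrange basis polynomials of a large grid in \<open>k\<^bsup>J\<^esup>\<close> outnumber the monomials in \<open>I\<close> that
  occur in their pullbacks, so some non-trivial combination of them pulls back to zero; evaluating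
  it at the grid points shows that it does not vanish identically.\<close>

lemma dominant_image_obstruction:
  fixes \<phi> :: "('i \<Rightarrow> 'k::field_char_0) \<Rightarrow> 'j \<Rightarrow> 'k"
  assumes I: "finite I" and J: "finite J" and card: "card I < card J"
    and poly: "\<And>j. j \<in> J \<Longrightarrow> (\<lambda>u. \<phi> u j) \<in> polynomial_functions (coordinate_functions I)"
  obtains P v where "P \<in> polynomial_functions (coordinate_functions J)"
    and "\<And>u. P (\<phi> u) = 0" and "P v \<noteq> 0"
proof -
  obtain \<delta>' where \<delta>': "\<And>j. j \<in> J \<Longrightarrow> (\<lambda>u. \<phi> u j) \<in> bounded_degree I (\<delta>' j)"
    using polynomial_bounded_degree[OF I poly] by metis
  define \<delta> where "\<delta> = Max (insert 0 (\<delta>' ` J))"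
  have \<delta>: "(\<lambda>u. \<phi> u j) \<in> bounded_degree I \<delta>" if "j \<in> J" for j
    using that J by (intro bounded_degree_mono[OF _ \<delta>'[OF that]]) (auto simp: \<delta>_def)
  \<comment> \<open>This \<open>K\<close> satisfies
    \<open>card J * (D * \<delta>) + 1 \<le> K * (D + 1)\<close> for every \<open>D\<close>. With
    \<open>D = K ^ card I\<close>, the factor \<open>K ^ card I\<close> is absorbed by one further
    factor \<open>D + 1\<close>, which is available because \<open>card I < card J\<close>.\<close>
  define K where "K = card J * \<delta> + 1"
  define D where "D = K ^ card I"
  \<comment> \<open>Characteristic zero keeps these \<open>D + 1\<close> values distinct.\<close>
  define G where "G = (of_nat ` {..D} :: 'k set)"
  have G: "finite G" "card G = D + 1"
    unfolding G_def by (simp_all add: card_image inj_on_def)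
  define grid where "grid = (J \<rightarrow>\<^sub>E G)"
  have grid: "finite grid" "card grid = (D + 1) ^ card J"
    using J G by (simp_all add: grid_def finite_PiE card_PiE)
  define L where "L p v = (\<Prod>j\<in>J. \<Prod>c\<in>G - {p j}. (v j - c) / (p j - c))" for p v :: "'j \<Rightarrow> 'k"
  have L_poly: "L p \<in> polynomial_functions (coordinate_functions J)" for p
  proof -
    have "(\<lambda>v. inverse (p j - c) * (v j - c)) \<in> polynomial_functions (coordinate_functions J)"
      if "j \<in> J" for j c
      using that by (intro polynomial_functions.mult polynomial_functions.const
        polynomial_functions_diff coordinate_polynomial)
    then have "(\<lambda>v. \<Prod>j\<in>J. \<Prod>c\<in>G - {p j}. inverse (p j - c) * (v j - c))
        \<in> polynomial_functions (coordinate_functions J)"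
      by (intro polynomial_functions_prod)
    then show ?thesis by (simp add: L_def[abs_def] divide_inverse mult.commute)
  qed
  have L_grid: "L p q = (if p = q then 1 else 0)" if pq: "p \<in> grid" "q \<in> grid" for p q
  proof (cases "p = q")
    case True
    then have "(\<Prod>c\<in>G - {p j}. (q j - c) / (p j - c)) = 1" for j by (intro prod.neutral) auto
    then show ?thesis using True unfolding L_def by simp
  next
    case False
    then obtain j where j: "j \<in> J" "p j \<noteq> q j"
      using pq unfolding grid_def by (metis PiE_ext)
    moreover have "q j \<in> G" using pq j by (auto simp: grid_def)
    ultimately have "(\<Prod>c\<in>G - {p j}. (q j - c) / (p j - c)) = 0"
      using G by (auto intro!: bexI[of _ "q j"])
    then have "L p q = 0" unfolding L_def using J j by auto
    then show ?thesis using False by simp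
  qed
  define \<psi> where "\<psi> p u = L p (\<phi> u)" for p u
  \<comment> \<open>For each \<open>j\<close> exactly one point of \<open>G\<close> is left out, so
    there are \<open>D\<close> factors, each of degree at most \<open>\<delta>\<close> in every
    variable.\<close>
  have \<psi>_deg: "\<psi> p \<in> bounded_degree I (card J * (D * \<delta>))" if p: "p \<in> grid" for p
  proof -
    have factor: "(\<lambda>u. (\<phi> u j - c) / (p j - c)) \<in> bounded_degree I \<delta>" if "j \<in> J" for j c
    proof -
      have "(\<lambda>u. \<phi> u j + - c) \<in> bounded_degree I \<delta>"
        using that by (intro bounded_degree_add \<delta> bounded_degree_const)
      then have "(\<lambda>u. inverse (p j - c) * (\<phi> u j + - c)) \<in> bounded_degree I \<delta>"
        by (rule function_space.span_scale)
      then show ?thesis by (simp add: divide_inverse mult.commute)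
    qed
    have "(\<lambda>u. \<Prod>c\<in>G - {p j}. (\<phi> u j - c) / (p j - c)) \<in> bounded_degree I (D * \<delta>)"
      if j: "j \<in> J" for j
    proof -
      have "p j \<in> G" using p j by (auto simp: grid_def)
      then have "card (G - {p j}) = D" using G by simp
      then show ?thesis
        using bounded_degree_prod[of "G - {p j}" "\<lambda>c u. (\<phi> u j - c) / (p j - c)" I \<delta>] G factor[OF j]
        by simp
    qed
    from bounded_degree_prod[OF J this] show ?thesis by (simp add: \<psi>_def[abs_def] L_def)
  qed
  have count: "(card J * (D * \<delta>) + 1) ^ card I < card grid"
  proof -
    have "card J * (D * \<delta>) + 1 \<le> K * (D + 1)" by (simp add: K_def algebra_simps)
    then have "(card J * (D * \<delta>) + 1) ^ card I \<le> (K * (D + 1)) ^ card I"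
      by (rule power_mono) simp
    also have "\<dots> = D * (D + 1) ^ card I" unfolding power_mult_distrib by (simp only: D_def)
    also have "\<dots> < (D + 1) ^ Suc (card I)" by simp
    also have "\<dots> \<le> card grid" unfolding grid(2) using card by (intro power_increasing) auto
    finally show ?thesis .
  qed
  \<comment> \<open>The relation must be indexed by grid points, whereas linear dependence speaks of
    the set of pullbacks. If two grid points have the same pullback, that set may be too small for
    the count, but the difference of the two basis polynomials is then a relation already.\<close>
  have "\<exists>c. (\<exists>p\<in>grid. c p \<noteq> 0) \<and> (\<forall>u. (\<Sum>p\<in>grid. c p * \<psi> p u) = 0)"
  proof (cases "inj_on \<psi> grid")
    case True
    have "function_space.dependent (\<psi> ` grid)"
    proof (rule ccontr)
      assume "\<not> ?thesis"
      then have "card (\<psi> ` grid) \<le> card (monomials I (card J * (D * \<delta>)) :: (('i \<Rightarrow> 'k) \<Rightarrow> 'k) set)"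
        using function_space.independent_span_bound[OF finite_monomials[OF I]] \<psi>_deg by blast
      also have "\<dots> \<le> (card J * (D * \<delta>) + 1) ^ card I" by (rule card_monomials_le[OF I])
      finally show False using count True by (simp add: card_image)
    qed
    then obtain c where c: "\<exists>v\<in>\<psi> ` grid. c v \<noteq> 0" "(\<Sum>v\<in>\<psi> ` grid. (\<lambda>u. c v * v u)) = 0"
      using function_space.dependent_finite[of "\<psi> ` grid"] grid by auto
    have "(\<Sum>p\<in>grid. c (\<psi> p) * \<psi> p u) = 0" for u
      using fun_cong[OF c(2), of u] True by (simp add: sum.reindex sum_fun_apply)
    then show ?thesis using c(1) by (intro exI[of _ "c \<circ> \<psi>"]) auto
  next
    case False
    then obtain p q where pq: "p \<in> grid" "q \<in> grid" "p \<noteq> q" "\<psi> p = \<psi> q"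
      by (auto simp: inj_on_def)
    define c where "c = (\<lambda>r. if r = p then 1 else if r = q then -1 else 0 :: 'k)"
    have "(\<Sum>r\<in>grid. c r * \<psi> r u) = 0" for u
    proof -
      have "(\<Sum>r\<in>grid. c r * \<psi> r u) = (\<Sum>r\<in>{p, q}. c r * \<psi> r u)"
        using pq grid by (intro sum.mono_neutral_right) (auto simp: c_def)
      then show ?thesis using pq by (simp add: c_def)
    qed
    then show ?thesis using pq(1) by (intro exI[of _ c]) (auto simp: c_def)
  qed
  then obtain c p where c: "p \<in> grid" "c p \<noteq> 0" "\<And>u. (\<Sum>p\<in>grid. c p * \<psi> p u) = 0" by blast
  show thesis
  proof (rule that)
    show "(\<lambda>v. \<Sum>p\<in>grid. c p * L p v) \<in> polynomial_functions (coordinate_functions J)"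
      by (intro polynomial_functions_sum polynomial_functions.mult polynomial_functions.const L_poly)
    show "(\<Sum>p\<in>grid. c p * L p (\<phi> u)) = 0" for u using c(3) by (simp add: \<psi>_def)
    \<comment> \<open>At the grid point \<open>p\<close> every basis polynomial except
      \<open>L p\<close> vanishes, so only \<open>c p\<close> remains.\<close>
    have "(\<Sum>q\<in>grid. c q * L q p) = (\<Sum>q\<in>grid. if q = p then c q else 0)"
      using c(1) by (intro sum.cong) (auto simp: L_grid)
    then show "(\<Sum>q\<in>grid. c q * L q p) \<noteq> 0" using c grid by simp
  qed
qed

section \<open>Codimension in affine space\<close>

text \<open>An affine space with coordinates indexed by \<open>J\<close>. Its points stay abstract,
  so that families of matrices can be taken directly; \<open>mk\<close> accepts functions on the
  whole index type but depends only on their values on \<open>J\<close>.\<close>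

locale affine_space =
  fixes X :: "'p set" and J :: "'j set" and x :: "'j \<Rightarrow> 'p \<Rightarrow> 'k::field_char_0"
    and mk :: "('j \<Rightarrow> 'k) \<Rightarrow> 'p"
  assumes finite_J: "finite J"
    and mk_in: "mk v \<in> X"
    and x_mk: "j \<in> J \<Longrightarrow> x j (mk v) = v j"
    and eqI: "p \<in> X \<Longrightarrow> q \<in> X \<Longrightarrow> (\<And>j. j \<in> J \<Longrightarrow> x j p = x j q) \<Longrightarrow> p = q"
begin

lemma mk_x: "p \<in> X \<Longrightarrow> mk (\<lambda>j. x j p) = p"
  by (rule eqI) (auto simp: mk_in x_mk)

lemma mk_cong: "(\<And>j. j \<in> J \<Longrightarrow> v j = w j) \<Longrightarrow> mk v = mk w"
  by (rule eqI) (auto simp: mk_in x_mk)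

abbreviation T :: "'p topology" where "T \<equiv> zariski_topology X (x ` J)"
abbreviation cl :: "'p set \<Rightarrow> 'p set" where "cl \<equiv> zariski_closure X (x ` J)"

definition shift :: "'j \<Rightarrow> 'k \<Rightarrow> 'p \<Rightarrow> 'p" where
  "shift j0 t p = mk (\<lambda>j. x j p + (if j = j0 then t else 0))"

lemma closure_of_image_irreducible:
  assumes "\<And>j. j \<in> J \<Longrightarrow> (\<lambda>u. x j (\<phi> u)) \<in> polynomial_functions (coordinate_functions I)"
    and "range \<phi> \<subseteq> X"
  shows "irreducible_closedin T (cl (range \<phi>))"
  using assms by (intro irreducible_closure_of_image[of \<phi> X "x ` J" I]) auto

lemma irreducible_space: "irreducible_closedin T X"
proof -
  have "range mk = X" using mk_in mk_x by (metis image_subset_iff rangeI subsetI subset_antisym)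
  moreover have "irreducible_closedin T (cl (range mk))"
    using mk_in by (intro closure_of_image_irreducible[of _ J]) (auto simp: x_mk intro: coordinate_polynomial)
  moreover have "cl X = X" using closure_of_topspace[of T] by simp
  ultimately show ?thesis by simp
qed

text \<open>With fewer parameters than coordinates, some non-zero polynomial in the coordinates
  vanishes on the image, hence on its closure.\<close>

lemma closure_of_image_proper:
  assumes poly: "\<And>j. j \<in> J \<Longrightarrow> (\<lambda>u. x j (\<phi> u)) \<in> polynomial_functions (coordinate_functions I)"
    and X: "range \<phi> \<subseteq> X" and I: "finite I" "card I < card J"
  shows "cl (range \<phi>) \<noteq> X"
proof -
  obtain P v where P: "P \<in> polynomial_functions (coordinate_functions J)"
    "\<And>u. P (\<lambda>j. x j (\<phi> u)) = 0" "P v \<noteq> 0"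
    using dominant_image_obstruction[OF I(1) finite_J I(2), of "\<lambda>u j. x j (\<phi> u)"] poly by metis
  \<comment> \<open>The coordinates of \<open>mk v\<close> agree with \<open>v\<close> only on
    \<open>J\<close>, so non-vanishing at \<open>v\<close> passes to \<open>mk v\<close> because
    \<open>P\<close> involves no other variables.\<close>
  have ext: "P w = P w'" if "\<And>j. j \<in> J \<Longrightarrow> w j = w' j" for w w'
    using P(1) by induction (auto simp: coordinate_functions_def that)
  let ?f = "\<lambda>p. P (\<lambda>j. x j p)"
  have "?f \<in> polynomial_functions (x ` J)"
    using P(1) by (rule polynomial_functions_compose)
      (auto simp: coordinate_functions_def intro: polynomial_functions.coord)
  then have "closedin T (zero_locus X {?f})" by (auto simp: closedin_zariski)
  moreover have "range \<phi> \<subseteq> zero_locus X {?f}" using X P(2) by (auto simp: zero_locus_def)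
  ultimately have "cl (range \<phi>) \<subseteq> zero_locus X {?f}" by (intro closure_of_minimal)
  moreover have "?f (mk v) \<noteq> 0" using P(3) ext[of "\<lambda>j. x j (mk v)" v] x_mk by simp
  ultimately show ?thesis using mk_in[of v] by (auto simp: zero_locus_def)
qed

text \<open>Translation is a polynomial map, so the equations of \<open>W\<close> pull back to
  polynomial equations.\<close>

lemma closedin_shift_preimage:
  assumes "closedin T W"
  shows "closedin T {p \<in> X. shift j0 t p \<in> W}"
proof -
  obtain F where F: "F \<subseteq> polynomial_functions (x ` J)" "W = zero_locus X F"
    using assms by (auto simp: closedin_zariski)
  have "(\<lambda>p. f (shift j0 t p)) \<in> polynomial_functions (x ` J)" if "f \<in> F" for f
  proof (rule polynomial_functions_compose[of f "x ` J" "shift j0 t"])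
    show "f \<in> polynomial_functions (x ` J)" using that F by auto
    show "(\<lambda>p. c (shift j0 t p)) \<in> polynomial_functions (x ` J)" if c: "c \<in> x ` J" for c
    proof -
      obtain j where j: "j \<in> J" "c = x j" using c by auto
      have "(\<lambda>p. x j p + (if j = j0 then t else 0)) \<in> polynomial_functions (x ` J)"
        using j by (intro polynomial_functions.add polynomial_functions.coord polynomial_functions.const) auto
      then show ?thesis using j by (simp add: shift_def x_mk)
    qed
  qed
  then have "(\<lambda>f p. f (shift j0 t p)) ` F \<subseteq> polynomial_functions (x ` J)" by (rule image_subsetI)
  moreover have "{p \<in> X. shift j0 t p \<in> W} = zero_locus X ((\<lambda>f p. f (shift j0 t p)) ` F)"
    unfolding F by (auto simp: zero_locus_def shift_def mk_in)
  ultimately show ?thesis unfolding closedin_zariski by (intro exI conjI)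
qed

text \<open>Any point is reached from a given one by changing one coordinate at a time, and each
  change is a translation along an axis.\<close>

lemma shift_invariant_eq_space:
  assumes "W \<subseteq> X" "W \<noteq> {}" and shift: "\<And>j t p. j \<in> J \<Longrightarrow> p \<in> W \<Longrightarrow> shift j t p \<in> W"
  shows "W = X"
proof -
  obtain p where p: "p \<in> W" using assms by auto
  have "q \<in> W" if q: "q \<in> X" for q
  proof -
    have "mk (\<lambda>j. if j \<in> K then x j q else x j p) \<in> W" if "finite K" "K \<subseteq> J" for K
      using that
    proof (induction K)
      case empty
      then show ?case using p assms(1) mk_x by auto
    next
      case (insert k K)
      let ?r = "mk (\<lambda>j. if j \<in> K then x j q else x j p)"
      have "shift k (x k q - x k p) ?r \<in> W"
        using insert by (intro shift) auto
      moreover have "shift k (x k q - x k p) ?r = mk (\<lambda>j. if j \<in> insert k K then x j q else x j p)"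
        unfolding shift_def using insert.hyps by (intro mk_cong) (auto simp: x_mk)
      ultimately show ?case by simp
    qed
    from this[OF finite_J] have "mk (\<lambda>j. if j \<in> J then x j q else x j p) \<in> W" by simp
    moreover have "mk (\<lambda>j. if j \<in> J then x j q else x j p) = mk (\<lambda>j. x j q)" by (rule mk_cong) simp
    ultimately show ?thesis using q by (simp add: mk_x)
  qed
  then show ?thesis using assms(1) by auto
qed

text \<open>The margin of two is spent in two steps: the closure itself is proper, hence not
  invariant under all translations, and after a translation parameter is added there are still fewer
  parameters than coordinates.\<close>

lemma intermediate_irreducible:
  fixes \<phi> :: "('i \<Rightarrow> 'k) \<Rightarrow> 'p"
  assumes poly: "\<And>j. j \<in> J \<Longrightarrow> (\<lambda>u. x j (\<phi> u)) \<in> polynomial_functions (coordinate_functions I)"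
    and X: "range \<phi> \<subseteq> X" and I: "finite I" "card I + 2 \<le> card J"
  shows "\<exists>Z. irreducible_closedin T Z \<and> cl (range \<phi>) \<subset> Z \<and> Z \<subset> X"
proof -
  let ?W = "cl (range \<phi>)"
  have W: "?W \<subseteq> X" "range \<phi> \<subseteq> ?W" "closedin T ?W"
    using closure_of_subset_topspace[of T] X by (auto simp: closure_of_subset)
  have "?W \<noteq> X" using I by (intro closure_of_image_proper[OF poly X]) auto
  then obtain j0 t p where j0: "p \<in> ?W" "shift j0 t p \<notin> ?W"
    using shift_invariant_eq_space[of ?W] W by blast
  \<comment> \<open>\<open>None\<close> carries the length of the translation along
    \<open>j0\<close>, and \<open>Some i\<close> the old parameter \<open>i\<close>.\<close>
  define \<phi>' where "\<phi>' u = shift j0 (u None) (\<phi> (\<lambda>i. u (Some i)))" for u :: "'i option \<Rightarrow> 'k"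
  define I' where "I' = insert None (Some ` I)"
  have I': "finite I'" "card I' < card J"
    using I by (auto simp: I'_def card_insert_if card_image)
  have poly': "(\<lambda>u. x j (\<phi>' u)) \<in> polynomial_functions (coordinate_functions I')" if j: "j \<in> J" for j
  proof -
    have "(\<lambda>u. x j (\<phi> (\<lambda>i. u (Some i)))) \<in> polynomial_functions (coordinate_functions I')"
      using poly[OF j] by (rule polynomial_functions_compose)
        (auto simp: coordinate_functions_def I'_def intro!: polynomial_functions.coord)
    moreover have "(\<lambda>u. if j = j0 then u None else 0) \<in> polynomial_functions (coordinate_functions I')"
      by (cases "j = j0") (auto simp: I'_def intro: coordinate_polynomial polynomial_functions.const)
    ultimately show ?thesis using j by (auto simp: \<phi>'_def shift_def x_mk intro: polynomial_functions.add)
  qed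
  have X': "range \<phi>' \<subseteq> X" by (auto simp: \<phi>'_def shift_def mk_in)
  let ?Z = "cl (range \<phi>')"
  have Z: "?Z \<subseteq> X" "range \<phi>' \<subseteq> ?Z"
    using closure_of_subset_topspace[of T] X' by (auto simp: closure_of_subset)
  have reach: "shift j0 s (\<phi> u) \<in> range \<phi>'" for s u
    by (rule range_eqI[of _ _ "\<lambda>i. case i of None \<Rightarrow> s | Some i \<Rightarrow> u i"]) (simp add: \<phi>'_def)
  have "\<phi> u \<in> range \<phi>'" for u
  proof -
    have "shift j0 0 (\<phi> u) = \<phi> u" using X mk_x[of "\<phi> u"] by (auto simp: shift_def)
    then show ?thesis using reach[of 0 u] by simp
  qed
  then have "?W \<subseteq> ?Z" by (intro closure_of_mono) auto
  moreover have "?Z \<noteq> ?W"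
  proof
    \<comment> \<open>In this case translation by \<open>t\<close> would send the image into
      \<open>?W\<close>. The preimage of \<open>?W\<close> under it is closed, so all of
      \<open>?W\<close> would be sent into \<open>?W\<close>, contrary to the choice of
      \<open>p\<close>.\<close>
    assume eq: "?Z = ?W"
    then have "range \<phi> \<subseteq> {p \<in> X. shift j0 t p \<in> ?W}" using reach Z X by blast
    then have "?W \<subseteq> {p \<in> X. shift j0 t p \<in> ?W}"
      by (rule closure_of_minimal) (rule closedin_shift_preimage[OF W(3)])
    then show False using j0 by auto
  qed
  moreover have "?Z \<noteq> X" by (rule closure_of_image_proper[OF poly' X' I'])
  moreover have "irreducible_closedin T ?Z" by (rule closure_of_image_irreducible[OF poly' X'])
  ultimately show ?thesis using Z(1) by blast
qed

text \<open>An irreducible closed set in the closure of \<open>S\<close> lies in the closure of a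
  single image, since there are finitely many. The intermediate set for that image and the whole
  space extend it to a chain of length two.\<close>

lemma codim_ge_2:
  fixes \<phi> :: "'s \<Rightarrow> ('i \<Rightarrow> 'k) \<Rightarrow> 'p"
  assumes "finite A" and S: "S \<subseteq> (\<Union>s\<in>A. range (\<phi> s))"
    and poly: "\<And>s j. s \<in> A \<Longrightarrow> j \<in> J \<Longrightarrow>
      (\<lambda>u. x j (\<phi> s u)) \<in> polynomial_functions (coordinate_functions (I s))"
    and X: "\<And>s. s \<in> A \<Longrightarrow> range (\<phi> s) \<subseteq> X"
    and I: "\<And>s. s \<in> A \<Longrightarrow> finite (I s)" "\<And>s. s \<in> A \<Longrightarrow> card (I s) + 2 \<le> card J"
  shows "codim T S \<ge> 2"
  unfolding codim_def
proof (rule INF_greatest)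
  fix Y assume "Y \<in> {Y. irreducible_closedin T Y \<and> Y \<subseteq> cl S}"
  then have Y: "irreducible_closedin T Y" "Y \<subseteq> cl S" by auto
  have "range (\<phi> s) \<subseteq> cl (range (\<phi> s))" if "s \<in> A" for s
    using X[OF that] by (simp add: closure_of_subset)
  then have "(\<Union>s\<in>A. range (\<phi> s)) \<subseteq> (\<Union>s\<in>A. cl (range (\<phi> s)))"
    by (intro UN_mono subset_refl)
  then have "S \<subseteq> (\<Union>s\<in>A. cl (range (\<phi> s)))" using S by (rule order_trans[rotated])
  moreover have "closedin T (\<Union>s\<in>A. cl (range (\<phi> s)))"
    using \<open>finite A\<close> by (intro closedin_Union) auto
  ultimately have "cl S \<subseteq> (\<Union>s\<in>A. cl (range (\<phi> s)))" by (rule closure_of_minimal)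
  then have "Y \<subseteq> (\<Union>s\<in>A. cl (range (\<phi> s)))" by (rule order_trans[OF Y(2)])
  then have "\<exists>s\<in>A. Y \<subseteq> cl (range (\<phi> s))"
    by (rule irreducible_subset_finite_Union[OF Y(1) \<open>finite A\<close> closedin_closure_of])
  then obtain s where s: "s \<in> A" "Y \<subseteq> cl (range (\<phi> s))" by (rule bexE)
  have "\<exists>Z. irreducible_closedin T Z \<and> cl (range (\<phi> s)) \<subset> Z \<and> Z \<subset> X"
    by (rule intermediate_irreducible[of "\<phi> s" "I s",
      OF poly[OF s(1)] X[OF s(1)] I(1)[OF s(1)] I(2)[OF s(1)]])
  then obtain Z where Z: "irreducible_closedin T Z" "cl (range (\<phi> s)) \<subset> Z" "Z \<subset> X"
    by (elim exE conjE)
  then have Y_Z: "Y \<subset> Z" using s(2) by (elim subset_psubset_trans[rotated])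
  define chain where "chain i = (if i = 0 then Y else if i = 1 then Z else X)" for i :: nat
  have irred: "irreducible_closedin T (chain i)" for i
    using Y(1) Z(1) irreducible_space by (simp add: chain_def)
  have "chain i \<subset> chain (Suc i)" if "i < 2" for i
  proof -
    have "i = 0 \<or> i = 1" using that by auto
    then show ?thesis using Y_Z Z(3) by (elim disjE) (simp_all add: chain_def)
  qed
  with irred have "chain 0 = Y \<and> (\<forall>i\<le>2. irreducible_closedin T (chain i)) \<and> (\<forall>i<2. chain i \<subset> chain (Suc i))"
    by (simp add: chain_def)
  then have "enat 2 \<le> irreducible_codim T Y" unfolding irreducible_codim_def by (intro Sup_upper) blast
  then show "2 \<le> irreducible_codim T Y" by (simp add: numeral_eq_enat)
qed

end

section \<open>Subspaces as graphs\<close>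

text \<open>\<open>B\<close> is a smallest set of coordinates that determines the vectors of
  \<open>U\<close>. Minimality yields vectors of \<open>U\<close> dual to these coordinates; they
  form a basis of \<open>U\<close>, and their remaining entries are the coefficients of the
  graph.\<close>

lemma subspace_eq_graph:
  fixes U :: "'k::field vec set"
  assumes U: "VectorSpace.subspace class_ring U (module_vec TYPE('k) n)"
  obtains B A where "B \<subseteq> {..<n}"
    and "card B = vectorspace.dim class_ring ((module_vec TYPE('k) n)\<lparr>carrier := U\<rparr>)"
    and "U = {x \<in> carrier_vec n. \<forall>r\<in>{..<n} - B. x $ r = (\<Sum>b\<in>B. A r b * x $ b)}"
proof -
  interpret vec_space "TYPE('k)" n .
  have sm: "submodule class_ring U V" using U by (simp add: VectorSpace.subspace_def)
  note submod = submodule.subset[OF sm] submodule.m_closed[OF sm] submodule.zero_closed[OF sm]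
    submodule.smult_closed[OF sm]
  have U_carrier: "x \<in> carrier_vec n" if "x \<in> U" for x using submod(1) that by (auto simp: module_vec_simps)
  have U_add: "x + y \<in> U" if "x \<in> U" "y \<in> U" for x y using submod(2)[OF that] by (simp add: module_vec_simps)
  have U_zero: "0\<^sub>v n \<in> U" using submod(3) by (simp add: module_vec_simps)
  have U_smult: "c \<cdot>\<^sub>v x \<in> U" if "x \<in> U" for c x using submod(4)[OF _ that, of c] by (simp add: module_vec_simps)
  \<comment> \<open>This says that the projection of \<open>U\<close> to the coordinates in
    \<open>B\<close> is injective.\<close>
  define separates where
    "separates B \<longleftrightarrow> B \<subseteq> {..<n} \<and> (\<forall>x\<in>U. (\<forall>b\<in>B. x $ b = 0) \<longrightarrow> x = 0\<^sub>v n)" for B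
  have "separates {..<n}"
    unfolding separates_def using U_carrier by (auto intro!: eq_vecI)
  then obtain B where B: "separates B" "\<And>B'. separates B' \<Longrightarrow> card B \<le> card B'"
    using ex_has_least_nat[of separates "{..<n}" card] by blast
  have Bn: "B \<subseteq> {..<n}" "finite B" using B(1) finite_subset by (auto simp: separates_def)
  have "\<exists>u\<in>U. \<forall>b'\<in>B. u $ b' = (if b' = b then 1 else 0)" if b: "b \<in> B" for b
  proof -
    \<comment> \<open>A non-zero vector of \<open>U\<close> that vanishes on \<open>B - {b}\<close>
      must be non-zero at \<open>b\<close>; rescaling it gives the dual vector.\<close>
    have "\<not> separates (B - {b})" using B(2)[of "B - {b}"] b Bn(2) card_Diff1_less[of B b] by auto
    then obtain x where x: "x \<in> U" "\<forall>b'\<in>B - {b}. x $ b' = 0" "x \<noteq> 0\<^sub>v n"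
      using Bn by (auto simp: separates_def)
    have "x $ b \<noteq> 0" using x B(1) by (auto simp: separates_def)
    then have "\<forall>b'\<in>B. ((1 / x $ b) \<cdot>\<^sub>v x) $ b' = (if b' = b then 1 else 0)"
      using x Bn U_carrier[OF x(1)] by auto
    then show ?thesis using U_smult[OF x(1)] by blast
  qed
  then obtain u where u: "\<And>b. b \<in> B \<Longrightarrow> u b \<in> U"
    "\<And>b b'. b \<in> B \<Longrightarrow> b' \<in> B \<Longrightarrow> u b $ b' = (if b' = b then 1 else 0)"
    by metis
  have u_carrier: "u ` B \<subseteq> carrier_vec n" using u U_carrier by auto
  have comb_in: "vec n (\<lambda>r. \<Sum>b\<in>K. c b * u b $ r) \<in> U" if "finite K" "K \<subseteq> B" for K c
    using that
  proof (induction K)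
    case empty
    then show ?case using U_zero by (simp add: zero_vec_def)
  next
    case (insert k K)
    have "vec n (\<lambda>r. \<Sum>b\<in>insert k K. c b * u b $ r) = c k \<cdot>\<^sub>v u k + vec n (\<lambda>r. \<Sum>b\<in>K. c b * u b $ r)"
      using insert u U_carrier[OF u(1)[of k]] by (intro eq_vecI) auto
    then show ?case using insert u by (auto intro: U_add U_smult)
  qed
  have comb: "vec n (\<lambda>r. \<Sum>b\<in>B. x $ b * u b $ r) = x" if x: "x \<in> U" for x
  proof -
    \<comment> \<open>The difference lies in \<open>U\<close> and vanishes on \<open>B\<close>, so
      it is zero by separation.\<close>
    let ?y = "x + (-1) \<cdot>\<^sub>v vec n (\<lambda>r. \<Sum>b\<in>B. x $ b * u b $ r)"
    have "?y \<in> U" using x comb_in[OF Bn(2)] by (auto intro: U_add U_smult)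
    moreover have "?y $ b = 0" if "b \<in> B" for b
    proof -
      have "b < n" using that Bn by auto
      moreover have "(\<Sum>b'\<in>B. x $ b' * u b' $ b) = (\<Sum>b'\<in>B. if b = b' then x $ b' else 0)"
        using that u by (intro sum.cong) auto
      ultimately show ?thesis using that Bn U_carrier[OF x] by simp
    qed
    ultimately have y: "?y = 0\<^sub>v n" using B(1) by (auto simp: separates_def)
    show ?thesis
    proof (rule eq_vecI)
      fix i assume "i < dim_vec x"
      then have "i < n" using U_carrier[OF x] by auto
      moreover have "?y $ i = 0" using y \<open>i < n\<close> by simp
      ultimately show "vec n (\<lambda>r. \<Sum>b\<in>B. x $ b * u b $ r) $ i = x $ i"
        using U_carrier[OF x] by simp
    qed (use U_carrier[OF x] in auto)
  qed
  have inj: "inj_on u B"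
    using u(2) by (intro inj_onI) (metis zero_neq_one)
  have sum_u: "(\<Sum>v\<in>u ` B. f v) = (\<Sum>b\<in>B. f (u b))" for f :: "'k vec \<Rightarrow> 'k"
    using inj by (simp add: sum.reindex)
  interpret U: vectorspace class_ring "V\<lparr>carrier := U\<rparr>"
    using U by (rule subspace_is_vs)
  have "lin_indpt (u ` B)"
  proof (rule finite_lin_indpt2)
    fix a assume a: "lincomb a (u ` B) = 0\<^sub>v n"
    have "a (u b) = 0" if b: "b \<in> B" for b
    proof -
      have bn: "b < n" using b Bn by auto
      have "0 = lincomb a (u ` B) $ b" using a bn by simp
      also have "\<dots> = (\<Sum>b'\<in>B. a (u b') * u b' $ b)" using lincomb_index[OF bn u_carrier] by (simp add: sum_u)
      also have "\<dots> = (\<Sum>b'\<in>B. if b = b' then a (u b') else 0)" using u b by (intro sum.cong) auto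
      also have "\<dots> = a (u b)" using Bn b by simp
      finally show ?thesis by simp
    qed
    then show "\<forall>v\<in>u ` B. a v = 0" by auto
  qed (use Bn u_carrier in auto)
  moreover have "span (u ` B) = U"
  proof
    show "span (u ` B) \<subseteq> U" using u sm by (intro span_is_subset) auto
    show "U \<subseteq> span (u ` B)"
    proof
      fix x assume x: "x \<in> U"
      \<comment> \<open>\<open>lincomb\<close> takes coefficients indexed by vectors, so the
        coordinate \<open>b\<close> is recovered from \<open>u b\<close> by injectivity.\<close>
      define a where "a v = x $ the_inv_into B u v" for v
      have "lincomb a (u ` B) = x"
      proof (rule eq_vecI)
        fix i assume "i < dim_vec x"
        then have i: "i < n" using U_carrier[OF x] by auto
        have "lincomb a (u ` B) $ i = (\<Sum>b\<in>B. x $ b * u b $ i)"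
          unfolding lincomb_index[OF i u_carrier] sum_u
          by (intro sum.cong) (auto simp: a_def the_inv_into_f_f[OF inj])
        also have "\<dots> = x $ i" using i by (subst (2) comb[OF x, symmetric]) simp
        finally show "lincomb a (u ` B) $ i = x $ i" .
      next
        have "lincomb a (u ` B) \<in> carrier_vec n" using u_carrier by (intro lincomb_closed) auto
        then show "dim_vec (lincomb a (u ` B)) = dim_vec x" using U_carrier[OF x] by auto
      qed
      then show "x \<in> span (u ` B)" using finite_span[of "u ` B"] Bn u_carrier by auto
    qed
  qed
  \<comment> \<open>Independence and span were computed in the ambient space and are transferred
    here to \<open>U\<close> as a vector space of its own.\<close>
  ultimately have "U.basis (u ` B)"
    unfolding U.basis_def using u sm span_li_not_depend[of "u ` B" U] by auto
  then have "U.dim = card (u ` B)" using Bn by (intro U.dim_basis) auto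
  then have "card B = U.dim" using inj by (simp add: card_image)
  moreover have "U = {x \<in> carrier_vec n. \<forall>r\<in>{..<n} - B. x $ r = (\<Sum>b\<in>B. u b $ r * x $ b)}"
  proof (intro subset_antisym subsetI)
    fix x assume x: "x \<in> U"
    have "x $ r = (\<Sum>b\<in>B. u b $ r * x $ b)" if "r < n" for r
      using that by (subst (1) comb[OF x, symmetric]) (simp add: mult.commute)
    then show "x \<in> {x \<in> carrier_vec n. \<forall>r\<in>{..<n} - B. x $ r = (\<Sum>b\<in>B. u b $ r * x $ b)}"
      using U_carrier[OF x] by auto
  next
    fix x assume x: "x \<in> {x \<in> carrier_vec n. \<forall>r\<in>{..<n} - B. x $ r = (\<Sum>b\<in>B. u b $ r * x $ b)}"
    have "x = vec n (\<lambda>r. \<Sum>b\<in>B. x $ b * u b $ r)"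
    proof (rule eq_vecI)
      fix i assume "i < dim_vec (vec n (\<lambda>r. \<Sum>b\<in>B. x $ b * u b $ r))"
      then have i: "i < n" by simp
      show "x $ i = vec n (\<lambda>r. \<Sum>b\<in>B. x $ b * u b $ r) $ i"
      proof (cases "i \<in> B")
        case True
        have "(\<Sum>b\<in>B. x $ b * u b $ i) = (\<Sum>b\<in>B. if i = b then x $ b else 0)"
          using u True by (intro sum.cong) auto
        then show ?thesis using i True Bn by simp
      next
        case False
        then show ?thesis using i x by (simp add: mult.commute)
      qed
    qed (use x in auto)
    then show "x \<in> U" using comb_in[OF Bn(2), of "\<lambda>b. x $ b"] by simp
  qed
  ultimately show thesis using Bn(1) that[of B "\<lambda>r b. u b $ r"] by auto
qed

section \<open>Representations with a subrepresentation of given dimension\<close>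

text \<open>Apply \<open>N\<close> to the point of the graph above the basis vector of index
  \<open>c\<close> and compare coordinate \<open>r\<close>. All entries of \<open>N\<close> on the
  right lie outside the block with row not in \<open>B'\<close> and column in \<open>B\<close>, so
  they determine this block.\<close>

lemma invariant_graph_block:
  fixes N :: "'k::field mat"
  assumes N: "N \<in> carrier_mat m n" and B: "B \<subseteq> {..<n}" and B': "B' \<subseteq> {..<m}"
    and U: "U = {x \<in> carrier_vec n. \<forall>r\<in>{..<n} - B. x $ r = (\<Sum>b\<in>B. A r b * x $ b)}"
    and U': "U' = {x \<in> carrier_vec m. \<forall>r\<in>{..<m} - B'. x $ r = (\<Sum>b\<in>B'. A' r b * x $ b)}"
    and inv: "\<And>x. x \<in> U \<Longrightarrow> N *\<^sub>v x \<in> U'"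
    and r: "r \<in> {..<m} - B'" and c: "c \<in> B"
  shows "N $$ (r, c) = (\<Sum>b\<in>B'. A' r b * (N $$ (b, c) + (\<Sum>s\<in>{..<n} - B. N $$ (b, s) * A s c)))
    - (\<Sum>s\<in>{..<n} - B. N $$ (r, s) * A s c)"
proof -
  define x where "x = vec n (\<lambda>s. if s \<in> B then (if s = c then 1 else 0) else A s c)"
  have fin: "finite B" using B finite_subset by auto
  have "x $ s = (\<Sum>b\<in>B. A s b * x $ b)" if s: "s \<in> {..<n} - B" for s
  proof -
    have "(\<Sum>b\<in>B. A s b * x $ b) = (\<Sum>b\<in>B. if c = b then A s b else 0)"
      using B by (intro sum.cong) (auto simp: x_def)
    then show ?thesis using s c fin by (simp add: x_def)
  qed
  then have "x \<in> U" unfolding U by (auto simp: x_def)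
  then have img: "N *\<^sub>v x \<in> U'" by (rule inv)
  have entry: "(N *\<^sub>v x) $ i = N $$ (i, c) + (\<Sum>s\<in>{..<n} - B. N $$ (i, s) * A s c)" if i: "i < m" for i
  proof -
    have "(N *\<^sub>v x) $ i = (\<Sum>s<n. N $$ (i, s) * x $ s)"
      using N i by (auto simp: scalar_prod_def x_def atLeast0LessThan)
    also have "\<dots> = (\<Sum>s\<in>{..<n} - B. N $$ (i, s) * x $ s) + (\<Sum>s\<in>B. N $$ (i, s) * x $ s)"
      using B by (intro sum.subset_diff) auto
    also have "(\<Sum>s\<in>B. N $$ (i, s) * x $ s) = (\<Sum>s\<in>B. if c = s then N $$ (i, s) else 0)"
      using B by (intro sum.cong) (auto simp: x_def)
    also have "\<dots> = N $$ (i, c)" using c fin by simp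
    also have "(\<Sum>s\<in>{..<n} - B. N $$ (i, s) * x $ s) = (\<Sum>s\<in>{..<n} - B. N $$ (i, s) * A s c)"
      by (intro sum.cong) (auto simp: x_def)
    finally show ?thesis by simp
  qed
  have "(N *\<^sub>v x) $ r = (\<Sum>b\<in>B'. A' r b * (N *\<^sub>v x) $ b)" using img r unfolding U' by blast
  also have "\<dots> = (\<Sum>b\<in>B'. A' r b * (N $$ (b, c) + (\<Sum>s\<in>{..<n} - B. N $$ (b, s) * A s c)))"
    using B' by (intro sum.cong) (auto simp: entry)
  finally show ?thesis using entry[of r] r by (simp add: algebra_simps)
qed

section \<open>Matrix entries as coordinates, and the charts\<close>

definition rep_index :: "('v, 'a) pre_digraph \<Rightarrow> ('v \<Rightarrow> nat) \<Rightarrow> ('a \<times> nat \<times> nat) set" where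
  "rep_index Q d = (SIGMA a:arcs Q. {..<d (head Q a)} \<times> {..<d (tail Q a)})"

definition rep_coord :: "'a \<times> nat \<times> nat \<Rightarrow> ('a \<Rightarrow> 'k mat) \<Rightarrow> 'k" where
  "rep_coord = (\<lambda>(a, r, c) M. M a $$ (r, c))"

definition rep_of ::
  "('v, 'a) pre_digraph \<Rightarrow> ('v \<Rightarrow> nat) \<Rightarrow> ('a \<times> nat \<times> nat \<Rightarrow> 'k) \<Rightarrow> 'a \<Rightarrow> 'k mat" where
  "rep_of Q d v = (\<lambda>a\<in>arcs Q. mat (d (head Q a)) (d (tail Q a)) (\<lambda>(r, c). v (a, r, c)))"

lemma rep_coordinates_eq: "rep_coordinates Q d = rep_coord ` rep_index Q d"
proof -
  have "rep_coord ` rep_index Q d =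
    {rep_coord (a, r, c) | a r c. a \<in> arcs Q \<and> r < d (head Q a) \<and> c < d (tail Q a)}"
    by (force simp: rep_index_def)
  also have "\<dots> = rep_coordinates Q d" by (simp add: rep_coordinates_def rep_coord_def)
  finally show ?thesis ..
qed

lemma affine_space_rep_space:
  assumes "finite (arcs Q)"
  shows "affine_space (rep_space Q d) (rep_index Q d)
    (rep_coord :: _ \<Rightarrow> ('a \<Rightarrow> 'k::field_char_0 mat) \<Rightarrow> 'k) (rep_of Q d)"
proof
  show "finite (rep_index Q d)" using assms by (auto simp: rep_index_def)
  show "rep_of Q d v \<in> rep_space Q d" for v :: "'a \<times> nat \<times> nat \<Rightarrow> 'k"
    by (auto simp: rep_of_def rep_space_def)
  show "rep_coord j (rep_of Q d v) = v j" if "j \<in> rep_index Q d" for j and v :: "'a \<times> nat \<times> nat \<Rightarrow> 'k"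
    using that by (auto simp: rep_index_def rep_coord_def rep_of_def)
  fix M N :: "'a \<Rightarrow> 'k mat"
  assume MN: "M \<in> rep_space Q d" "N \<in> rep_space Q d"
    and eq: "\<And>j. j \<in> rep_index Q d \<Longrightarrow> rep_coord j M = rep_coord j N"
  show "M = N"
  proof (rule PiE_ext[OF MN[unfolded rep_space_def]])
    fix a assume a: "a \<in> arcs Q"
    have "M a \<in> carrier_mat (d (head Q a)) (d (tail Q a))" "N a \<in> carrier_mat (d (head Q a)) (d (tail Q a))"
      using MN a by (auto simp: rep_space_def)
    moreover have "M a $$ (r, c) = N a $$ (r, c)" if "r < d (head Q a)" "c < d (tail Q a)" for r c
      using eq[of "(a, r, c)"] a that by (simp add: rep_index_def rep_coord_def)
    ultimately show "M a = N a" by (intro eq_matI) auto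
  qed
qed

text \<open>The left summand indexes the coordinates of standard affine charts of Grassmannians, one
  for each vertex. The right summand omits the block of matrix entries from the subspace coordinates
  to the complementary ones, which invariance determines.\<close>

definition chart_index ::
  "('v, 'a) pre_digraph \<Rightarrow> ('v \<Rightarrow> nat) \<Rightarrow> ('v \<Rightarrow> nat set) \<Rightarrow> (('v \<times> nat \<times> nat) + ('a \<times> nat \<times> nat)) set" where
  "chart_index Q d B =
     (SIGMA i:verts Q. ({..<d i} - B i) \<times> B i) <+>
     (rep_index Q d - (SIGMA a:arcs Q. ({..<d (head Q a)} - B (head Q a)) \<times> B (tail Q a)))"

text \<open>Parametrises the representations that preserve a family of graphs of linear maps
  \<open>k\<^bsup>B i\<^esup> \<rightarrow> k\<^bsup>{..<d i} - B i\<^esup>\<close>: the \<open>Inl\<close> parameters are the entries of these maps, the \<open>Inr\<close>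
  parameters the entries of the representation that invariance leaves free.\<close>

definition chart ::
  "('v, 'a) pre_digraph \<Rightarrow> ('v \<Rightarrow> nat) \<Rightarrow> ('v \<Rightarrow> nat set) \<Rightarrow>
    (('v \<times> nat \<times> nat) + ('a \<times> nat \<times> nat) \<Rightarrow> 'k::field) \<Rightarrow> 'a \<Rightarrow> 'k mat" where
  "chart Q d B u = rep_of Q d (\<lambda>(a, r, c).
     let h = head Q a; t = tail Q a in
     if r \<notin> B h \<and> c \<in> B t then
       (\<Sum>b\<in>B h. u (Inl (h, r, b)) *
          (u (Inr (a, b, c)) + (\<Sum>s\<in>{..<d t} - B t. u (Inr (a, b, s)) * u (Inl (t, s, c)))))
       - (\<Sum>s\<in>{..<d t} - B t. u (Inr (a, r, s)) * u (Inl (t, s, c)))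
     else u (Inr (a, r, c)))"

text \<open>The formula for a determined entry uses only graph entries and matrix entries outside
  the determined block, so all its variables belong to \<open>chart_index\<close>.\<close>

lemma chart_polynomial:
  fixes Q :: "('v, 'a) pre_digraph"
  assumes Q: "wf_digraph Q" and B: "\<And>i. i \<in> verts Q \<Longrightarrow> B i \<subseteq> {..<d i}" and j: "j \<in> rep_index Q d"
  shows "(\<lambda>u :: _ \<Rightarrow> 'k::field. rep_coord j (chart Q d B u))
    \<in> polynomial_functions (coordinate_functions (chart_index Q d B))"
proof -
  interpret wf_digraph Q by (rule Q)
  obtain a r c where j_eq: "j = (a, r, c)" by (cases j)
  have arc: "a \<in> arcs Q" "r < d (head Q a)" "c < d (tail Q a)"
    using j by (auto simp: j_eq rep_index_def)
  note ht = head_in_verts[OF arc(1)] tail_in_verts[OF arc(1)]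
  note sub = B[OF ht(1), THEN subsetD] B[OF ht(2), THEN subsetD]
  have coord: "rep_coord j (chart Q d B u) =
    (let h = head Q a; t = tail Q a in
     if r \<notin> B h \<and> c \<in> B t then
       (\<Sum>b\<in>B h. u (Inl (h, r, b)) *
          (u (Inr (a, b, c)) + (\<Sum>s\<in>{..<d t} - B t. u (Inr (a, b, s)) * u (Inl (t, s, c)))))
       - (\<Sum>s\<in>{..<d t} - B t. u (Inr (a, r, s)) * u (Inl (t, s, c)))
     else u (Inr (a, r, c)))" for u :: "_ \<Rightarrow> 'k"
    using arc by (simp add: j_eq rep_coord_def chart_def rep_of_def)
  show ?thesis
  proof (cases "r \<notin> B (head Q a) \<and> c \<in> B (tail Q a)")
    case True
    have graph: "(\<lambda>u :: _ \<Rightarrow> 'k. u (Inl (i, s, b)))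
        \<in> polynomial_functions (coordinate_functions (chart_index Q d B))"
      if "i \<in> verts Q" "s < d i" "s \<notin> B i" "b \<in> B i" for i s b
      using that by (intro coordinate_polynomial) (auto simp: chart_index_def)
    have entry: "(\<lambda>u :: _ \<Rightarrow> 'k. u (Inr (a, s, b)))
        \<in> polynomial_functions (coordinate_functions (chart_index Q d B))"
      if "s < d (head Q a)" "b < d (tail Q a)" "s \<in> B (head Q a) \<or> b \<notin> B (tail Q a)" for s b
      using that arc by (intro coordinate_polynomial) (auto simp: chart_index_def rep_index_def)
    show ?thesis
      unfolding coord Let_def if_P[OF True]
      by (intro polynomial_functions_diff polynomial_functions_sum polynomial_functions.mult
          polynomial_functions.add graph entry) (use True arc ht sub in auto)
  next
    case False
    then have "Inr (a, r, c) \<in> chart_index Q d B"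
      using arc by (auto simp: chart_index_def rep_index_def)
    then show ?thesis unfolding coord Let_def if_not_P[OF False] by (rule coordinate_polynomial)
  qed
qed

text \<open>The graph entries contribute the vertex sum of the Euler form, and the omitted blocks
  contribute its arrow sum with negative sign.\<close>

lemma card_chart_index:
  fixes Q :: "('v, 'a) pre_digraph"
  assumes Q: "fin_digraph Q" and B: "\<And>i. i \<in> verts Q \<Longrightarrow> B i \<subseteq> {..<d i}"
  shows "finite (chart_index Q d B)"
    and "int (card (chart_index Q d B)) =
      int (card (rep_index Q d)) + euler_form Q (\<lambda>i. card (B i)) (\<lambda>i. d i - card (B i))"
proof -
  interpret fin_digraph Q by (rule Q)
  let ?V = "SIGMA i:verts Q. ({..<d i} - B i) \<times> B i"
  let ?N = "SIGMA a:arcs Q. ({..<d (head Q a)} - B (head Q a)) \<times> B (tail Q a)"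
  have fin: "finite (B i)" if "i \<in> verts Q" for i using B[OF that] finite_subset by auto
  have finV: "finite ?V" using fin by (auto intro: finite_SigmaI)
  have finR: "finite (rep_index Q d)" by (auto simp: rep_index_def)
  have sub: "?N \<subseteq> rep_index Q d"
    unfolding rep_index_def using B by (intro Sigma_mono subset_refl) auto
  show "finite (chart_index Q d B)"
    using finV finR by (auto simp: chart_index_def)
  have diff: "card ({..<d i} - B i) = d i - card (B i)" if "i \<in> verts Q" for i
    using B[OF that] fin[OF that] by (simp add: card_Diff_subset)
  have "card ?V = (\<Sum>i\<in>verts Q. (d i - card (B i)) * card (B i))"
    using fin by (simp add: card_SigmaI card_cartesian_product diff)
  moreover have "card ?N = (\<Sum>a\<in>arcs Q. (d (head Q a) - card (B (head Q a))) * card (B (tail Q a)))"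
    using fin by (simp add: card_SigmaI card_cartesian_product diff)
  moreover have "card (chart_index Q d B) = card ?V + (card (rep_index Q d) - card ?N)"
    using finV finR sub by (simp add: chart_index_def card_Plus card_Diff_subset finite_subset)
  \<comment> \<open>This makes the subtraction of natural numbers exact when passing to
    integers.\<close>
  moreover have "card ?N \<le> card (rep_index Q d)" using finR sub by (rule card_mono)
  ultimately show "int (card (chart_index Q d B)) =
      int (card (rep_index Q d)) + euler_form Q (\<lambda>i. card (B i)) (\<lambda>i. d i - card (B i))"
    by (simp add: euler_form_def of_nat_diff mult.commute)
qed

text \<open>Each \<open>U i\<close> is a graph over coordinates \<open>B i\<close>, and invariance
  forces the omitted entries of \<open>M\<close> to be those given by the chart. The last two
  conclusions transfer non-triviality and properness of \<open>U\<close> to the sizes of the sets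
  \<open>B i\<close>.\<close>

lemma subrepresentation_chart:
  fixes M :: "'a \<Rightarrow> 'k::field_char_0 mat"
  assumes Q: "fin_digraph Q" and M: "M \<in> rep_space Q d" and U: "subrepresentation Q d M U"
  obtains B where "B \<in> (\<Pi>\<^sub>E i\<in>verts Q. Pow {..<d i})" and "M \<in> range (chart Q d B)"
    and "\<And>i. i \<in> verts Q \<Longrightarrow> card (B i) = subrep_dim Q d U i"
    and "\<And>i. i \<in> verts Q \<Longrightarrow> B i = {} \<Longrightarrow> U i = {0\<^sub>v (d i)}"
    and "\<And>i. i \<in> verts Q \<Longrightarrow> B i = {..<d i} \<Longrightarrow> U i = carrier_vec (d i)"
proof -
  interpret fin_digraph Q by (rule Q)
  interpret affine_space "rep_space Q d" "rep_index Q d"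
    "rep_coord :: _ \<Rightarrow> ('a \<Rightarrow> 'k mat) \<Rightarrow> 'k" "rep_of Q d"
    by (rule affine_space_rep_space) simp
  define graph where "graph i B A \<longleftrightarrow> B \<subseteq> {..<d i} \<and> card B = subrep_dim Q d U i \<and>
      U i = {x \<in> carrier_vec (d i). \<forall>r\<in>{..<d i} - B. x $ r = (\<Sum>b\<in>B. A r b * x $ b)}" for i B A
  have "\<exists>B A. graph i B A" if i: "i \<in> verts Q" for i
  proof -
    have "VectorSpace.subspace class_ring (U i) (module_vec TYPE('k) (d i))"
      using U i by (auto simp: subrepresentation_def)
    then show ?thesis
      unfolding graph_def using i by (elim subspace_eq_graph) (auto simp: subrep_dim_def)
  qed
  then obtain B A where "\<And>i. i \<in> verts Q \<Longrightarrow> graph i (B i) (A i)" by metis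
  then have B: "B i \<subseteq> {..<d i}" "card (B i) = subrep_dim Q d U i"
    "U i = {x \<in> carrier_vec (d i). \<forall>r\<in>{..<d i} - B i. x $ r = (\<Sum>b\<in>B i. A i r b * x $ b)}"
    if "i \<in> verts Q" for i
    using that by (auto simp: graph_def)
  \<comment> \<open>Restriction to the vertices places the family in a finite set, so that finitely
    many charts suffice.\<close>
  define C where "C = restrict B (verts Q)"
  \<comment> \<open>The parameters are read off from the graphs and from \<open>M\<close>
    itself.\<close>
  define u where "u = (\<lambda>p. case p of Inl (i, r, b) \<Rightarrow> A i r b | Inr (a, r, c) \<Rightarrow> M a $$ (r, c))"
  have "M = chart Q d C u"
  proof (rule eqI[OF M])
    show "chart Q d C u \<in> rep_space Q d" by (simp add: chart_def mk_in)
    fix j assume j: "j \<in> rep_index Q d"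
    obtain a r c where j_eq: "j = (a, r, c)" by (cases j)
    have arc: "a \<in> arcs Q" "r < d (head Q a)" "c < d (tail Q a)"
      using j by (auto simp: j_eq rep_index_def)
    have ht: "head Q a \<in> verts Q" "tail Q a \<in> verts Q" using arc by auto
    have "M a $$ (r, c) = (\<Sum>b\<in>B (head Q a). A (head Q a) r b * (M a $$ (b, c) +
        (\<Sum>s\<in>{..<d (tail Q a)} - B (tail Q a). M a $$ (b, s) * A (tail Q a) s c)))
      - (\<Sum>s\<in>{..<d (tail Q a)} - B (tail Q a). M a $$ (r, s) * A (tail Q a) s c)"
      if rc: "r \<notin> B (head Q a)" "c \<in> B (tail Q a)"
    proof (rule invariant_graph_block[OF _ B(1)[OF ht(2)] B(1)[OF ht(1)] B(3)[OF ht(2)] B(3)[OF ht(1)]])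
      show "M a \<in> carrier_mat (d (head Q a)) (d (tail Q a))"
        using M arc by (auto simp: rep_space_def)
      show "M a *\<^sub>v x \<in> U (head Q a)" if "x \<in> U (tail Q a)" for x
        using U arc that by (auto simp: subrepresentation_def)
    qed (use rc arc in auto)
    then show "rep_coord j M = rep_coord j (chart Q d C u)"
      unfolding chart_def x_mk[OF j] using ht
      by (auto simp: j_eq rep_coord_def C_def u_def Let_def)
  qed
  then have "M \<in> range (chart Q d C)" by blast
  moreover have "U i = {0\<^sub>v (d i)}" if i: "i \<in> verts Q" "B i = {}" for i
    using B(3)[OF i(1)] i(2) by (auto intro!: eq_vecI)
  moreover have "U i = carrier_vec (d i)" if i: "i \<in> verts Q" "B i = {..<d i}" for i
    using B(3)[OF i(1)] i(2) by auto
  ultimately show thesis using B by (intro that[of C]) (auto simp: C_def)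
qed

section \<open>Decompositions of the dimension vector and the conclusion\<close>

lemma euler_form_cong:
  assumes "wf_digraph Q" "\<And>i. i \<in> verts Q \<Longrightarrow> e i = e' i" "\<And>i. i \<in> verts Q \<Longrightarrow> f i = f' i"
  shows "euler_form Q e f = euler_form Q e' f'"
proof -
  interpret wf_digraph Q by fact
  show ?thesis unfolding euler_form_def by (simp add: assms(2,3))
qed

text \<open>The slope of \<open>e + f\<close> is the mean of the two slopes weighted by the positive
  total dimensions. If the mean is at most the slope of \<open>e\<close>, then so is the slope of
  \<open>f\<close>.\<close>

lemma slope_complement_le:
  assumes Q: "finite (verts Q)" and \<Theta>: "is_stability Q \<Theta>"
    and e: "e \<in> dimension_vectors Q" "e \<noteq> (\<lambda>_. 0)"
    and f: "f \<in> dimension_vectors Q" "f \<noteq> (\<lambda>_. 0)"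
    and le: "slope Q \<Theta> (\<lambda>i. e i + f i) \<le> slope Q \<Theta> e"
  shows "slope Q \<Theta> f \<le> slope Q \<Theta> e"
proof -
  have pos: "(\<Sum>i\<in>verts Q. g i) > 0" if g: "g \<in> dimension_vectors Q" "g \<noteq> (\<lambda>_. 0)" for g
  proof -
    obtain i where "g i \<noteq> 0" using g(2) by auto
    moreover from this have "i \<in> verts Q" using g(1) by (auto simp: dimension_vectors_def)
    ultimately show ?thesis using Q by (auto intro!: sum_pos2[of _ i])
  qed
  define E F where "E = real (\<Sum>i\<in>verts Q. e i)" and "F = real (\<Sum>i\<in>verts Q. f i)"
  have EF: "E > 0" "F > 0" using pos[OF e] pos[OF f] by (simp_all only: E_def F_def of_nat_0_less_iff)
  have "\<Theta> (\<lambda>i. real (e i + f i)) = \<Theta> (\<lambda>i. real (e i)) + \<Theta> (\<lambda>i. real (f i))"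
    using \<Theta> e(1) f(1) by (simp add: is_stability_def real_vertex_space_def dimension_vectors_def)
  then have "(\<Theta> (\<lambda>i. real (e i)) + \<Theta> (\<lambda>i. real (f i))) / (E + F) \<le> \<Theta> (\<lambda>i. real (e i)) / E"
    using le by (simp add: slope_def E_def F_def sum.distrib)
  then have "\<Theta> (\<lambda>i. real (f i)) / F \<le> \<Theta> (\<lambda>i. real (e i)) / E"
    using EF by (simp add: field_simps)
  then show ?thesis by (simp add: slope_def E_def F_def)
qed

theorem proposition4p1:
  fixes Q :: "('v, 'a) pre_digraph"
    and \<Theta> :: "('v \<Rightarrow> real) \<Rightarrow> real"
    and d :: "'v \<Rightarrow> nat"
  assumes "fin_digraph Q"
    and "is_stability Q \<Theta>"
    and "stable_dimension_vector TYPE('k::{alg_closed_field, field_char_0}) Q \<Theta> d"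
    and "\<And>e f. \<lbrakk>e \<in> dimension_vectors Q; f \<in> dimension_vectors Q;
           e \<noteq> (\<lambda>_. 0); f \<noteq> (\<lambda>_. 0); d = (\<lambda>i. e i + f i);
           slope Q \<Theta> e \<ge> slope Q \<Theta> f\<rbrakk> \<Longrightarrow> euler_form Q e f \<le> -2"
  shows "amply_stable TYPE('k) Q \<Theta> d"
proof -
  interpret fin_digraph Q by fact
  interpret affine_space "rep_space Q d" "rep_index Q d"
    "rep_coord :: _ \<Rightarrow> ('a \<Rightarrow> 'k mat) \<Rightarrow> 'k" "rep_of Q d"
    by (rule affine_space_rep_space) simp
  have d: "d \<in> dimension_vectors Q" "\<exists>i\<in>verts Q. d i \<noteq> 0"
    using assms(3) by (auto simp: stable_dimension_vector_def stable_locus_def stable_rep_def)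
  \<comment> \<open>These families index the charts with at least two parameters fewer than
    \<open>rep_space Q d\<close> has coordinates.\<close>
  define A where "A = {B \<in> (\<Pi>\<^sub>E i\<in>verts Q. Pow {..<d i}).
    euler_form Q (\<lambda>i. card (B i)) (\<lambda>i. d i - card (B i)) \<le> -2}"
  have A: "B i \<subseteq> {..<d i}" if "B \<in> A" "i \<in> verts Q" for B i
    using that by (auto simp: A_def)
  have "\<exists>B\<in>A. M \<in> range (chart Q d B)" if M: "M \<in> rep_space Q d - stable_locus Q \<Theta> d"
    for M :: "'a \<Rightarrow> 'k mat"
  proof -
    have "M \<in> rep_space Q d" "\<not> stable_rep Q \<Theta> d M" using M by (auto simp: stable_locus_def)
    \<comment> \<open>As \<open>d\<close> is non-zero, a failure of stability must come from a
      destabilising subrepresentation.\<close>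
    then obtain U where U: "subrepresentation Q d M U" "\<exists>i\<in>verts Q. U i \<noteq> {0\<^sub>v (d i)}"
      "\<exists>i\<in>verts Q. U i \<noteq> carrier_vec (d i)" "slope Q \<Theta> d \<le> slope Q \<Theta> (subrep_dim Q d U)"
      using d(2) by (auto simp: stable_rep_def not_less)
    obtain B where B: "B \<in> (\<Pi>\<^sub>E i\<in>verts Q. Pow {..<d i})" "M \<in> range (chart Q d B)"
      "\<And>i. i \<in> verts Q \<Longrightarrow> card (B i) = subrep_dim Q d U i"
      "\<And>i. i \<in> verts Q \<Longrightarrow> B i = {} \<Longrightarrow> U i = {0\<^sub>v (d i)}"
      "\<And>i. i \<in> verts Q \<Longrightarrow> B i = {..<d i} \<Longrightarrow> U i = carrier_vec (d i)"
      by (rule subrepresentation_chart[OF assms(1) \<open>M \<in> rep_space Q d\<close> U(1)]) (rule that; simp)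
    define e where "e = subrep_dim Q d U"
    define f where "f = (\<lambda>i. d i - e i)"
    have Bi: "B i \<subseteq> {..<d i}" "finite (B i)" if "i \<in> verts Q" for i
      using B(1) that finite_subset[of "B i" "{..<d i}"] by auto
    have e_le: "e i \<le> d i" for i
    proof (cases "i \<in> verts Q")
      case True
      then show ?thesis using card_mono[OF _ Bi(1)[OF True]] B(3)[OF True] by (simp add: e_def)
    qed (simp add: e_def subrep_dim_def)
    have dims: "e \<in> dimension_vectors Q" "f \<in> dimension_vectors Q"
      using d(1) by (auto simp: dimension_vectors_def e_def f_def subrep_dim_def)
    have sum: "d = (\<lambda>i. e i + f i)" using e_le by (auto simp: f_def)
    obtain i where i: "i \<in> verts Q" "U i \<noteq> {0\<^sub>v (d i)}" using U(2) by auto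
    then have "e i > 0" using B(3,4)[OF i(1)] Bi(2)[OF i(1)] by (auto simp: e_def card_gt_0_iff[symmetric])
    then have e_nz: "e \<noteq> (\<lambda>_. 0)" by auto
    obtain j where j: "j \<in> verts Q" "U j \<noteq> carrier_vec (d j)" using U(3) by auto
    then have "B j \<subset> {..<d j}" using B(5)[OF j(1)] Bi(1)[OF j(1)] by auto
    then have "e j < d j" using psubset_card_mono[of "{..<d j}" "B j"] B(3)[OF j(1)] by (simp add: e_def)
    then have "f j \<noteq> 0" by (simp add: f_def)
    then have f_nz: "f \<noteq> (\<lambda>_. 0)" by auto
    \<comment> \<open>Instability compares \<open>e\<close> with \<open>d\<close>, while the
      assumption on the Euler form compares \<open>e\<close> with its complement
      \<open>f\<close>.\<close>
    have "slope Q \<Theta> f \<le> slope Q \<Theta> e"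
      by (rule slope_complement_le[OF finite_verts assms(2) dims(1) e_nz dims(2) f_nz])
        (use U(4) in \<open>simp add: sum[symmetric] e_def[symmetric]\<close>)
    then have "euler_form Q e f \<le> -2" by (rule assms(4)[OF dims e_nz f_nz sum])
    moreover have "euler_form Q e f = euler_form Q (\<lambda>i. card (B i)) (\<lambda>i. d i - card (B i))"
      using B(3) by (intro euler_form_cong wf_digraph_axioms) (simp_all add: e_def f_def)
    ultimately have "B \<in> A" using B(1) by (simp add: A_def)
    then show ?thesis using B(2) by blast
  qed
  then have cover: "(rep_space Q d - stable_locus Q \<Theta> d :: ('a \<Rightarrow> 'k mat) set)
      \<subseteq> (\<Union>B\<in>A. range (chart Q d B))"
    by (intro subsetI) (simp only: UN_iff)
  have "codim T (rep_space Q d - stable_locus Q \<Theta> d :: ('a \<Rightarrow> 'k mat) set) \<ge> 2"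
  proof (rule codim_ge_2[OF _ cover])
    have "finite (\<Pi>\<^sub>E i\<in>verts Q. Pow {..<d i})" by (intro finite_PiE) auto
    then show "finite A" by (rule rev_finite_subset) (auto simp: A_def)
    show "(\<lambda>u. rep_coord j (chart Q d B u)) \<in> polynomial_functions (coordinate_functions (chart_index Q d B))"
      if "B \<in> A" "j \<in> rep_index Q d" for B j
      using A[OF that(1)] that(2) by (rule chart_polynomial[OF wf_digraph_axioms])
    show "range (chart Q d B :: _ \<Rightarrow> 'a \<Rightarrow> 'k mat) \<subseteq> rep_space Q d" for B
      by (auto simp: chart_def mk_in)
    show "finite (chart_index Q d B)" if "B \<in> A" for B
      using A[OF that] by (rule card_chart_index[OF assms(1)])
    show "card (chart_index Q d B) + 2 \<le> card (rep_index Q d)" if "B \<in> A" for B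
    proof -
      have "int (card (chart_index Q d B)) =
          int (card (rep_index Q d)) + euler_form Q (\<lambda>i. card (B i)) (\<lambda>i. d i - card (B i))"
        using A[OF that] by (rule card_chart_index[OF assms(1)])
      moreover have "euler_form Q (\<lambda>i. card (B i)) (\<lambda>i. d i - card (B i)) \<le> -2"
        using that by (simp add: A_def)
      ultimately show ?thesis by linarith
    qed
  qed
  then show ?thesis
    using d(1) by (simp add: amply_stable_def rep_topology_def rep_coordinates_eq)
qed

end
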